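(* Let $G$ be a finite $Z$-group. Then the cyclic graph $\Delta(G)$ is disconnected if and only if $G$ is a Frobenius group.
   Context: A $Z$-group is a group in which every Sylow subgroup is cyclic. For a group $G$, the cyclic graph $\Delta(G)$ is the simple graph whose vertex set is $G^{\#}=G\setminus\{1\}$, with an edge between distinct vertices $x,y$ if and only if the subgroup $\langle x,y\rangle$ is cyclic. "Disconnected" means that there exist two vertices not joined by any path. A group $G$ is a Frobenius group if it has a nontrivial proper subgroup $H$ such that $H\cap H^{g}=\{1\}$ for each $g\in G\setminus H$, where $H^g=g^{-1}Hg$. *)

theory Defs
  imports
    "HOL-Algebra.Elementary_Groups"
    "HOL-Algebra.Coset"
    "HOL-Computational_Algebra.Primes"
    "Graph_Theory.Pair_Digraph"
    "Graph_Theory.Digraph_Component"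
begin

text \<open>
  These notions are meant for finite groups, where a Sylow \<open>p\<close>-subgroup is a subgroup whose order
  is the full power of \<open>p\<close> dividing the group order. Primes not dividing the order are allowed;
  they only contribute the trivial subgroup, which is cyclic.
\<close>

definition sylow_subgroup :: "nat \<Rightarrow> 'a set \<Rightarrow> ('a, 'b) monoid_scheme \<Rightarrow> bool"
  where "sylow_subgroup p P G \<longleftrightarrow>
    prime p \<and> subgroup P G \<and> card P = p ^ multiplicity p (order G)"

definition Z_group :: "('a, 'b) monoid_scheme \<Rightarrow> bool"
  where "Z_group G \<longleftrightarrow>
    group G \<and> (\<forall>p P. sylow_subgroup p P G \<longrightarrow> cyclic_group (G\<lparr>carrier := P\<rparr>))"

definition Frobenius_group :: "('a, 'b) monoid_scheme \<Rightarrow> bool"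
  where "Frobenius_group G \<longleftrightarrow>
    group G \<and>
    (\<exists>H. subgroup H G \<and> H \<noteq> {\<one>\<^bsub>G\<^esub>} \<and> H \<noteq> carrier G \<and>
      (\<forall>g \<in> carrier G - H. H \<inter> ((inv\<^bsub>G\<^esub> g <#\<^bsub>G\<^esub> H) #>\<^bsub>G\<^esub> g) = {\<one>\<^bsub>G\<^esub>}))"

text \<open>
  The simple graph is encoded as a symmetric, loop-free digraph: each edge \<open>{x, y}\<close> becomes the two
  arcs \<open>(x, y)\<close> and \<open>(y, x)\<close>.
\<close>

definition cyclic_graph :: "('a, 'b) monoid_scheme \<Rightarrow> 'a pair_pre_digraph"
  where "cyclic_graph G =
    \<lparr> pverts = carrier G - {\<one>\<^bsub>G\<^esub>},
      parcs = {(x, y). x \<in> carrier G - {\<one>\<^bsub>G\<^esub>} \<and> y \<in> carrier G - {\<one>\<^bsub>G\<^esub>} \<and> x \<noteq> y \<and>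
                       cyclic_group (subgroup_generated G {x, y})} \<rparr>"

lemma pair_graph_cyclic_graph:
  assumes "finite (carrier G)"
  shows "pair_graph (cyclic_graph G)"
proof
  have "parcs (cyclic_graph G) \<subseteq> carrier G \<times> carrier G"
    by (auto simp: cyclic_graph_def)
  then show "finite (parcs (cyclic_graph G))"
    using assms by (meson finite_SigmaI finite_subset)
qed (use assms in \<open>auto simp: cyclic_graph_def symmetric_def insert_commute intro!: symI\<close>)

text \<open>
  This is not the negation of \<^const>\<open>Digraph_Component.connected\<close>, which fails for the graph
  without vertices: the empty graph (arising from the trivial group) is not disconnected here.
\<close>

definition disconnected :: "('a, 'b) pre_digraph \<Rightarrow> bool"
  where "disconnected \<Gamma> \<longleftrightarrow> (\<exists>u \<in> verts \<Gamma>. \<exists>v \<in> verts \<Gamma>. \<not> u \<rightarrow>\<^sup>*\<^bsub>\<Gamma>\<^esub> v)"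

end

theory Submission
  imports Defs "HOL-Algebra.Sylow" "HOL-Algebra.Group_Action" "HOL-Algebra.Multiplicative_Group"
    "HOL-Number_Theory.Residues"
begin

text \<open>
  In a group with cyclic Sylow subgroups, commuting elements \<open>x, y \<noteq> \<one>\<close> lie in one component of the
  cyclic graph, and adjacent elements commute. So the components are those of the commuting
  graph.

  If \<open>H\<close> is a Frobenius complement, an element that commutes with a nontrivial element of \<open>H\<close> lies in
  \<open>H\<close>. Hence the nontrivial elements of \<open>H\<close> are separated from the elements outside \<open>H\<close>; this is
  \<open>disconnected_if_malnormal\<close>.

  Conversely, the group has a normal subgroup \<open>\<langle>z\<rangle>\<close> of prime order
  (\<open>exists_normal_prime_order_subgroup\<close>). If the graph is disconnected, some \<open>x\<close> is not in the
  component of \<open>z\<close>. Let \<open>K\<close> be the centralizer of \<open>z\<close> and \<open>B\<close> that of \<open>x\<close>. A nontrivial element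
  of \<open>K\<close> lies in the component of \<open>z\<close>, and one of \<open>B\<close> in the component of \<open>x\<close>, so the two never
  commute. Since \<open>K\<close> is normal with an abelian quotient, counting the conjugates of \<open>x\<close> under \<open>K\<close> shows
  that the whole group is \<open>K B\<close>, and then that \<open>B\<close> meets its other conjugates trivially
  (\<open>centralizer_malnormal\<close>). So \<open>B\<close> is a Frobenius complement.

  The normal subgroup of prime order is found by induction on the group order. Let \<open>p\<close> be the smallest
  prime divisor of the order and \<open>P\<close> a Sylow \<open>p\<close>-subgroup. The transfer to the quotient of \<open>P\<close> of order
  \<open>p\<close> is a nontrivial homomorphism (\<open>exists_nontrivial_character\<close>), so its kernel is a proper normal
  subgroup that inherits the hypothesis, unless it is trivial and the group is abelian. The
  inheritance rests on the fact that all subgroups of prime power order are cyclic, since they are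
  conjugate into Sylow subgroups (\<open>Z_group_prime_power_subgroups_cyclic\<close>).
\<close>

section \<open>Residues modulo a prime\<close>

text \<open>
  The multiplicative order of \<open>k\<close> modulo \<open>p\<close> divides the coprime numbers \<open>n\<close> and \<open>p - 1\<close>. For group elements this
  reads: an element whose order is prime to \<open>p - 1\<close> can only induce the trivial automorphism of a
  cyclic group of order \<open>p\<close>.
\<close>

lemma cong_1_if_power_cong_1:
  fixes k n p :: nat
  assumes p: "prime p" and pow: "[k ^ n = 1] (mod p)" and "n > 0" and cop: "coprime n (p - 1)"
  shows "[k = 1] (mod p)"
proof -
  have "\<not> p dvd k"
  proof
    assume "p dvd k"
    then have "p dvd k ^ n" using \<open>n > 0\<close> by (simp add: dvd_power_iff_le dvd_trans dvd_power)
    then have "p dvd 1" using pow by (meson cong_dvd_iff)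
    then show False using p by simp
  qed
  then have fermat: "[k ^ (p - 1) = 1] (mod p)" using p by (intro fermat_theorem)
  obtain a b where ab: "n * a = (p - 1) * b + 1"
    using bezout_nat[of n "p - 1"] \<open>n > 0\<close> cop by (auto simp: coprime_iff_gcd_eq_1)
  have "[(k ^ n) ^ a = 1 ^ a] (mod p)" using pow by (rule cong_pow)
  then have "[k ^ ((p - 1) * b + 1) = 1] (mod p)" by (simp add: ab flip: power_mult)
  moreover have "[(k ^ (p - 1)) ^ b * k = 1 ^ b * k] (mod p)"
    using fermat by (intro cong_mult cong_pow) auto
  then have "[k ^ ((p - 1) * b + 1) = k] (mod p)"
    by (simp only: power_mult power_add power_one power_one_right mult_1)
  ultimately show ?thesis by (metis cong_sym cong_trans)
qed


lemma coprime_minus_1_if_least_prime: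
  fixes n p :: nat
  assumes "prime p" and "\<And>q. prime q \<Longrightarrow> q dvd n \<Longrightarrow> p \<le> q"
  shows "coprime n (p - 1)"
proof (rule ccontr)
  assume "\<not> coprime n (p - 1)"
  then obtain q where q: "prime q" "q dvd n" "q dvd p - 1"
    by (metis coprime_iff_gcd_eq_1 gcd_nat.boundedE prime_factor_nat)
  have "p > 1" using assms(1) prime_gt_1_nat by blast
  then have "q \<le> p - 1" using q(3) by (intro dvd_imp_le) auto
  with assms(2)[OF q(1,2)] \<open>p > 1\<close> show False by simp
qed

lemma obtain_inverse_mod_prime:
  fixes a b p :: nat
  assumes "prime p" and "\<not> p dvd a"
  obtains c where "[a * c = b] (mod p)"
proof -
  have "coprime a p" using assms by (metis coprime_commute prime_imp_coprime)
  then obtain c where "[a * c = 1] (mod p)" using cong_solve_coprime_nat by force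
  then have "[a * c * b = 1 * b] (mod p)" by (intro cong_mult) auto
  then show ?thesis using that[of "c * b"] by (simp add: mult.assoc)
qed

lemma eq_prime_power_if_only_prime_divisor:
  fixes n p :: nat
  assumes "n > 0" and "prime p" and "\<And>q. prime q \<Longrightarrow> q dvd n \<Longrightarrow> q = p"
  obtains k where "n = p ^ k"
proof -
  obtain m where m: "n = p ^ multiplicity p n * m" "\<not> p dvd m"
    using assms(1,2) by (metis multiplicity_decompose' not_prime_unit less_numeral_extra(3))
  have "m = 1"
  proof (rule ccontr)
    assume "m \<noteq> 1"
    then obtain q where "prime q" "q dvd m" using prime_factor_nat by blast
    then show False using assms(3)[of q] m by (metis dvd_mult)
  qed
  with m(1) have "n = p ^ multiplicity p n" by (metis mult_1_right)
  then show ?thesis by (rule that)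
qed

section \<open>Conjugation and powers\<close>

context group
begin

lemma inv_mult_cancel_left [simp]:
  assumes "x \<in> carrier G" "y \<in> carrier G"
  shows "inv x \<otimes> (x \<otimes> y) = y" "x \<otimes> (inv x \<otimes> y) = y"
  using assms by (simp_all flip: m_assoc)

abbreviation conjugate :: "'a \<Rightarrow> 'a \<Rightarrow> 'a"
  where "conjugate g x \<equiv> g \<otimes> x \<otimes> inv g"

lemma conj_mult:
  assumes "g \<in> carrier G" "x \<in> carrier G" "y \<in> carrier G"
  shows "conjugate g (x \<otimes> y) = conjugate g x \<otimes> conjugate g y"
  using assms by (simp add: m_assoc)

lemma conj_conj:
  assumes "g \<in> carrier G" "h \<in> carrier G" "x \<in> carrier G"
  shows "conjugate g (conjugate h x) = conjugate (g \<otimes> h) x"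
  using assms by (simp add: m_assoc inv_mult_group)

lemma conj_inv_cancel:
  assumes "g \<in> carrier G" "x \<in> carrier G"
  shows "conjugate (inv g) (conjugate g x) = x" "conjugate g (conjugate (inv g) x) = x"
  using assms by (simp_all add: m_assoc)

lemma conj_pow:
  assumes "g \<in> carrier G" "x \<in> carrier G"
  shows "conjugate g (x [^] (n::nat)) = conjugate g x [^] n"
proof (induction n)
  case (Suc n)
  then show ?case using assms by (simp add: conj_mult)
qed (use assms in simp)

lemma conj_eq_self_iff:
  assumes "g \<in> carrier G" "x \<in> carrier G"
  shows "conjugate g x = x \<longleftrightarrow> g \<otimes> x = x \<otimes> g"
proof
  assume "conjugate g x = x"
  then have "conjugate g x \<otimes> g = x \<otimes> g" by simp
  then show "g \<otimes> x = x \<otimes> g" using assms by (simp add: m_assoc)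
qed (use assms in \<open>simp add: m_assoc\<close>)

lemma commute_pow:
  assumes "x \<in> carrier G" "y \<in> carrier G" "x \<otimes> y = y \<otimes> x"
  shows "x [^] (i::nat) \<otimes> y [^] (j::nat) = y [^] j \<otimes> x [^] i"
proof -
  have *: "a [^] n \<otimes> b = b \<otimes> a [^] n"
    if "a \<in> carrier G" "b \<in> carrier G" "a \<otimes> b = b \<otimes> a" for a b and n :: nat
  proof (induction n)
    case (Suc n)
    have "a [^] Suc n \<otimes> b = a [^] n \<otimes> (a \<otimes> b)" using that by (simp add: m_assoc)
    also have "\<dots> = (a [^] n \<otimes> b) \<otimes> a" using that by (simp add: m_assoc)
    also have "\<dots> = b \<otimes> a [^] Suc n" using that Suc by (simp add: m_assoc)
    finally show ?case .
  qed (use that in simp)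
  show ?thesis using *[of x "y [^] j" i] *[of y x j] assms by simp
qed

lemma pow_eq_pow_if_cong:
  assumes "x \<in> carrier G" and "[i = j] (mod ord x)"
  shows "x [^] (i::nat) = x [^] j"
proof -
  have "int (ord x) dvd int i - int j"
    using assms(2) by (simp add: cong_iff_dvd_diff flip: cong_int_iff)
  then have "x [^] int j = x [^] int i" using assms(1) by (simp add: int_pow_eq)
  then show ?thesis by (simp add: int_pow_int)
qed

lemma cong_if_pow_eq_pow:
  assumes "x \<in> carrier G" and "x [^] (i::nat) = x [^] j"
  shows "[i = j] (mod ord x)"
proof -
  have "x [^] int j = x [^] int i" using assms(2) by (simp add: int_pow_int)
  then have "int (ord x) dvd int i - int j" using assms(1) by (simp add: int_pow_eq)
  then show ?thesis by (simp add: cong_iff_dvd_diff flip: cong_int_iff)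
qed

lemma obtain_prime_order_power:
  assumes "finite (carrier G)" "x \<in> carrier G" "x \<noteq> \<one>"
  obtains k :: nat where "prime (ord (x [^] k))" "x [^] k \<noteq> \<one>"
proof -
  have "ord x \<noteq> 1" using assms ord_eq_1 by blast
  then obtain p where p: "prime p" "p dvd ord x" using prime_factor_nat by blast
  then obtain k where k: "ord x = p * k" by blast
  have "ord x > 0" using assms ord_ge_1 by fastforce
  then have "k > 0" using k by simp
  have "ord (x [^] k) = p"
    using ord_pow[of x k] assms(2) k \<open>k > 0\<close> by simp
  moreover from this have "x [^] k \<noteq> \<one>" using p(1) by auto
  ultimately show ?thesis using that[of k] p(1) by simp
qed

lemma power_of_power_of_prime_order:
  assumes "prime (p::nat)" "w \<in> carrier G" "w [^] p = \<one>" "w [^] (a::nat) \<noteq> \<one>"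
  obtains c :: nat where "w [^] (b::nat) = (w [^] a) [^] c"
proof -
  have ord: "ord w dvd p" using assms by (simp flip: pow_eq_id)
  have "\<not> p dvd a" using assms ord by (metis dvd_trans pow_eq_id)
  then obtain c where "[a * c = b] (mod p)" using obtain_inverse_mod_prime assms(1) by blast
  then have "[a * c = b] (mod ord w)" using ord by (rule cong_dvd_modulus_nat)
  then have "w [^] (a * c) = w [^] b" using assms(2) by (rule pow_eq_pow_if_cong[rotated])
  then show ?thesis using that[of c] assms(2) by (simp add: nat_pow_pow)
qed

lemma subgroup_nat_pow_closed:
  assumes "subgroup H G" "x \<in> H"
  shows "x [^] (n::nat) \<in> H"
  using assms by (induction n) (auto simp: subgroup.one_closed subgroup.m_closed)

lemma subgroup_if_mult_closed:
  assumes "finite (carrier G)" "H \<subseteq> carrier G" "\<one> \<in> H"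
    and closed: "\<And>x y. x \<in> H \<Longrightarrow> y \<in> H \<Longrightarrow> x \<otimes> y \<in> H"
  shows "subgroup H G"
proof (rule subgroupI)
  fix x assume x: "x \<in> H"
  have "x [^] (n::nat) \<in> H" for n
    using x assms by (induction n) auto
  moreover have "inv x = x [^] (ord x - 1)"
  proof (rule inv_equality)
    have "ord x \<ge> 1" using assms x ord_ge_1 by blast
    then have "x [^] (ord x - 1) \<otimes> x = x [^] ord x"
      using nat_pow_Suc[of x "ord x - 1"] by simp
    then show "x [^] (ord x - 1) \<otimes> x = \<one>" using x assms by (simp add: subset_iff)
  qed (use x assms in auto)
  ultimately show "inv x \<in> H" by simp
qed (use assms in auto)

text \<open>
  A generator is the smallest positive power of \<open>x\<close> in \<open>Q\<close>, by division with remainder.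
\<close>

lemma subgroup_of_powers_cyclic:
  assumes "finite (carrier G)" and Q: "subgroup Q G" and x: "x \<in> carrier G"
    and sub: "\<And>y. y \<in> Q \<Longrightarrow> \<exists>i::nat. y = x [^] i"
  obtains w where "w \<in> Q" "\<And>y. y \<in> Q \<Longrightarrow> \<exists>i::nat. y = w [^] i"
proof -
  define m where "m = (LEAST m::nat. m > 0 \<and> x [^] m \<in> Q)"
  have "ord x > 0 \<and> x [^] ord x \<in> Q"
    using assms ord_ge_1[of x] by (simp add: subgroup.one_closed)
  then have m: "m > 0" "x [^] m \<in> Q" unfolding m_def by (metis (mono_tags, lifting) LeastI)+
  show ?thesis
  proof (rule that[OF m(2)])
    fix y assume y: "y \<in> Q"
    then obtain n :: nat where n: "y = x [^] n" using sub by blast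
    have "y = (x [^] m) [^] (n div m) \<otimes> x [^] (n mod m)"
      using x n by (simp add: nat_pow_pow nat_pow_mult)
    then have "x [^] (n mod m) = inv ((x [^] m) [^] (n div m)) \<otimes> y"
      using x by simp
    moreover have "inv ((x [^] m) [^] (n div m)) \<otimes> y \<in> Q"
      using Q m(2) y by (simp add: subgroup.m_closed subgroup.m_inv_closed subgroup_nat_pow_closed)
    ultimately have "x [^] (n mod m) \<in> Q" by simp
    then have "n mod m = 0"
      using not_less_Least[of "n mod m" "\<lambda>m. m > 0 \<and> x [^] m \<in> Q"] m(1)
      by (fold m_def) auto
    then have "y = (x [^] m) [^] (n div m)"
      using \<open>y = (x [^] m) [^] (n div m) \<otimes> x [^] (n mod m)\<close> x by simp
    then show "\<exists>i::nat. y = (x [^] m) [^] i" by blast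
  qed
qed

lemma cyclic_subgroup_generator:
  assumes "finite (carrier G)" and P: "subgroup P G" and cyc: "cyclic_group (G\<lparr>carrier := P\<rparr>)"
  obtains x where "x \<in> P" "\<And>y. y \<in> P \<Longrightarrow> \<exists>i::nat. y = x [^] i"
proof -
  interpret P: group "G\<lparr>carrier := P\<rparr>" using P by (rule subgroup_imp_group)
  have fin: "finite P" using assms by (meson finite_subset subgroup.subset)
  obtain x where x: "x \<in> P" "subgroup_generated (G\<lparr>carrier := P\<rparr>) {x} = G\<lparr>carrier := P\<rparr>"
    using cyc unfolding cyclic_group_def by auto
  then have "generate (G\<lparr>carrier := P\<rparr>) {x} = P"
    using carrier_subgroup_generated[of "G\<lparr>carrier := P\<rparr>" "{x}"] by simp
  then have "P = {x [^]\<^bsub>G\<lparr>carrier := P\<rparr>\<^esub> k | k. k \<in> (UNIV::nat set)}"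
    using P.generate_pow_on_finite_carrier[of x] fin x(1) by simp
  then show ?thesis using that[OF x(1)] by (auto simp flip: nat_pow_consistent)
qed

end

section \<open>Subgroups of prime power order\<close>

lemma group_actionI:
  fixes G (structure)
  assumes "group G"
    and closed: "\<And>g x. g \<in> carrier G \<Longrightarrow> x \<in> E \<Longrightarrow> f g x \<in> E"
    and one: "\<And>x. x \<in> E \<Longrightarrow> f \<one> x = x"
    and mult: "\<And>g h x. g \<in> carrier G \<Longrightarrow> h \<in> carrier G \<Longrightarrow> x \<in> E \<Longrightarrow> f (g \<otimes> h) x = f g (f h x)"
  shows "group_action G E (\<lambda>g. restrict (f g) E)"
proof -
  interpret group G by fact
  have bij: "restrict (f g) E \<in> Bij E" if g: "g \<in> carrier G" for g
  proof -
    have "bij_betw (f g) E E"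
      by (rule bij_betw_byWitness[where f' = "f (inv g)"])
        (use g closed one in \<open>auto simp flip: mult\<close>)
    then show ?thesis by (simp add: Bij_def cong: bij_betw_cong)
  qed
  show ?thesis
  proof (intro group_action.intro group_hom.intro group_hom_axioms.intro homI)
    fix g h assume gh: "g \<in> carrier G" "h \<in> carrier G"
    show "restrict (f (g \<otimes> h)) E = restrict (f g) E \<otimes>\<^bsub>BijGroup E\<^esub> restrict (f h) E"
      using bij[OF gh(1)] bij[OF gh(2)] closed mult gh
      by (auto simp: BijGroup_def compose_def restrict_def fun_eq_iff)
  next
    fix g assume "g \<in> carrier G"
    then show "restrict (f g) E \<in> carrier (BijGroup E)" using bij by (simp add: BijGroup_def)
  qed (simp_all add: group_BijGroup is_group)
qed

text \<open>
  Without a fixed point, every orbit length would be a power of \<open>p\<close> greater than 1, and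
  \<open>p\<close> would divide the size of the set.
\<close>

lemma (in group_action) prime_power_order_fixed_point:
  assumes "finite E" and p: "prime p" and ord: "order G = p ^ k" and ndvd: "\<not> p dvd card E"
  obtains x where "x \<in> E" "\<And>g. g \<in> carrier G \<Longrightarrow> \<phi> g x = x"
proof -
  have "\<exists>x\<in>E. \<forall>g\<in>carrier G. \<phi> g x = x"
  proof (rule ccontr)
    assume no_fix: "\<not> ?thesis"
    have sub: "B \<subseteq> E" if "B \<in> orbits G E \<phi>" for B
      using that element_image by (auto simp: orbits_def orbit_def)
    have "p dvd card B" if B: "B \<in> orbits G E \<phi>" for B
    proof (rule ccontr)
      assume "\<not> p dvd card B"
      obtain x where x: "x \<in> E" "B = orbit G \<phi> x" using B by (auto simp: orbits_def)
      have "card B dvd p ^ k"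
        using orbit_stabilizer_theorem[OF x(1)] ord x(2) by (metis dvd_triv_left)
      then obtain j where "card B = p ^ j" using p by (auto simp: divides_primepow_nat)
      with \<open>\<not> p dvd card B\<close> have "card B = 1" by (cases j) auto
      then have "B = {x}" using orbit_refl[OF x(1)] x(2) by (auto simp: card_1_singleton_iff)
      then have "\<phi> g x = x" if "g \<in> carrier G" for g
        using x(2) that by (auto simp: orbit_def)
      then show False using no_fix x(1) by blast
    qed
    then have "p dvd (\<Sum>B\<in>orbits G E \<phi>. card B)" by (rule dvd_sum)
    also have "(\<Sum>B\<in>orbits G E \<phi>. card B) = (\<Sum>B\<in>orbits G E \<phi>. \<Sum>x\<in>B. 1)" by simp
    also have "\<dots> = (\<Sum>x\<in>E. 1)"
      using partition.disjoint_sum[OF orbit_partition \<open>finite E\<close>] .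
    finally show False using ndvd by simp
  qed
  then show ?thesis using that by blast
qed

text \<open>
  A coset \<open>P #> g\<close> is fixed by the right translations with \<open>Q\<close> exactly if \<open>g Q g\<inverse> \<subseteq> P\<close>, so this is
  the fixed point lemma for \<open>Q\<close> acting on the cosets of \<open>P\<close>.
\<close>

lemma (in group) conjugate_into_coprime_index:
  assumes fin: "finite (carrier G)" and P: "subgroup P G" and Q: "subgroup Q G"
    and p: "prime p" and card: "card Q = p ^ k" and ndvd: "\<not> p dvd card (rcosets P)"
  obtains g where "g \<in> carrier G" "\<And>q. q \<in> Q \<Longrightarrow> conjugate g q \<in> P"
proof -
  let ?Q = "G\<lparr>carrier := Q\<rparr>" and ?\<phi> = "\<lambda>q T. T #> inv q"
  have Pc: "P \<subseteq> carrier G" and Qc: "Q \<subseteq> carrier G" using P Q by (simp_all add: subgroup.subset)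
  have shift: "(P #> a) #> b = P #> (a \<otimes> b)" if "a \<in> carrier G" "b \<in> carrier G" for a b
    using that Pc by (rule coset_mult_assoc[rotated])
  interpret act: group_action ?Q "rcosets P" "\<lambda>q. restrict (?\<phi> q) (rcosets P)"
  proof (rule group_actionI)
    show "group ?Q" using Q by (rule subgroup_imp_group)
  qed (use Pc Qc in \<open>auto simp: RCOSETS_def shift inv_mult_group m_assoc subset_iff\<close>)
  have "finite (rcosets P)" using fin by (simp add: RCOSETS_def)
  then obtain T where T: "T \<in> rcosets P" "\<And>q. q \<in> Q \<Longrightarrow> T #> inv q = T"
    using act.prime_power_order_fixed_point[OF _ p _ ndvd, of k] card
    by (auto simp: order_def)
  then obtain g where g: "g \<in> carrier G" "T = P #> g" by (auto simp: RCOSETS_def)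
  show ?thesis
  proof (rule that[OF g(1)])
    fix q assume q: "q \<in> Q"
    then have "inv q \<in> Q" and qc: "q \<in> carrier G" using Q Qc by (auto intro: subgroup.m_inv_closed)
    then have "P #> (g \<otimes> q) = P #> g" using T(2)[of "inv q"] g by (simp add: shift)
    moreover have "g \<otimes> q \<in> P #> (g \<otimes> q)" using g qc P by (intro rcos_self) auto
    ultimately obtain u where "u \<in> P" "g \<otimes> q = u \<otimes> g" by (auto simp: r_coset_def)
    then show "conjugate g q \<in> P" using g qc Pc by (auto simp: m_assoc)
  qed
qed

text \<open>
  Unlike the condition on Sylow subgroups, this reformulation is visibly inherited by subgroups. It
  speaks of natural powers of a generator, which suffice in a finite group, so that no
  subgroup has to be turned into a group of its own.
\<close>

definition prime_power_subgroups_cyclic :: "('a, 'b) monoid_scheme \<Rightarrow> bool"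
  where "prime_power_subgroups_cyclic G \<longleftrightarrow>
    (\<forall>p k Q. prime (p::nat) \<longrightarrow> subgroup Q G \<longrightarrow> card Q = p ^ k \<longrightarrow>
      (\<exists>x\<in>Q. \<forall>y\<in>Q. \<exists>i::nat. y = x [^]\<^bsub>G\<^esub> i))"

lemma (in group) obtain_sylow_subgroup:
  assumes fin: "finite (carrier G)" and p: "prime p"
  obtains P where "sylow_subgroup p P G" "\<not> p dvd card (rcosets P)"
proof -
  define a where "a = multiplicity p (order G)"
  have "order G > 0" using fin by (simp add: order_gt_0_iff_finite)
  then obtain m where m: "order G = p ^ a * m" "\<not> p dvd m"
    unfolding a_def using p by (metis multiplicity_decompose' not_prime_unit less_numeral_extra(3))
  obtain P where P: "subgroup P G" "card P = p ^ a"
    using sylow_thm[OF p is_group m(1) fin] by blast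
  have "card (rcosets P) * p ^ a = p ^ a * m" using lagrange[OF P(1)] P(2) m(1) by simp
  then have "card (rcosets P) = m" using p by (simp add: prime_gt_0_nat mult.commute)
  then show ?thesis using that[of P] P p m(2) by (simp add: sylow_subgroup_def a_def)
qed

lemma Z_group_prime_power_subgroups_cyclic:
  assumes fin: "finite (carrier G)" and Z: "Z_group G"
  shows "prime_power_subgroups_cyclic G"
  unfolding prime_power_subgroups_cyclic_def
proof (intro allI impI)
  interpret group G using Z by (simp add: Z_group_def)
  fix p k Q assume p: "prime (p::nat)" and Q: "subgroup Q G" and card: "card Q = p ^ k"
  obtain P where P: "sylow_subgroup p P G" "\<not> p dvd card (rcosets\<^bsub>G\<^esub> P)"
    using obtain_sylow_subgroup[OF fin p] by blast
  then have PG: "subgroup P G" and "cyclic_group (G\<lparr>carrier := P\<rparr>)"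
    using Z by (auto simp: Z_group_def sylow_subgroup_def)
  then obtain x where x: "x \<in> P" "\<And>y. y \<in> P \<Longrightarrow> \<exists>i::nat. y = x [^]\<^bsub>G\<^esub> i"
    using cyclic_subgroup_generator[OF fin] by metis
  obtain g where g: "g \<in> carrier G" "\<And>q. q \<in> Q \<Longrightarrow> conjugate g q \<in> P"
    using conjugate_into_coprime_index[OF fin PG Q p card P(2)] by blast
  have xc: "x \<in> carrier G" using x(1) PG by (simp add: subgroup.mem_carrier)
  have "\<exists>i::nat. q = conjugate (inv\<^bsub>G\<^esub> g) x [^]\<^bsub>G\<^esub> i" if q: "q \<in> Q" for q
  proof -
    obtain i :: nat where "conjugate g q = x [^]\<^bsub>G\<^esub> i" using g(2)[OF q] x(2) by blast
    then have "conjugate (inv\<^bsub>G\<^esub> g) (conjugate g q) = conjugate (inv\<^bsub>G\<^esub> g) (x [^]\<^bsub>G\<^esub> i)" by simp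
    then show ?thesis
      using g(1) xc q Q conj_pow[of "inv\<^bsub>G\<^esub> g" x i] conj_inv_cancel(1)[of g q] subgroup.mem_carrier[OF Q q]
      by (metis inv_closed)
  qed
  moreover have "conjugate (inv\<^bsub>G\<^esub> g) x \<in> carrier G" using g(1) xc by simp
  ultimately obtain w where "w \<in> Q" "\<And>q. q \<in> Q \<Longrightarrow> \<exists>i::nat. q = w [^]\<^bsub>G\<^esub> i"
    using subgroup_of_powers_cyclic[OF fin Q] by blast
  then show "\<exists>x\<in>Q. \<forall>y\<in>Q. \<exists>i::nat. y = x [^]\<^bsub>G\<^esub> i" by blast
qed

lemma (in group) prime_power_subgroups_cyclic_subgroup:
  assumes "prime_power_subgroups_cyclic G" and "subgroup M G"
  shows "prime_power_subgroups_cyclic (G\<lparr>carrier := M\<rparr>)"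
  using assms incl_subgroup[OF assms(2)]
  unfolding prime_power_subgroups_cyclic_def by (simp flip: nat_pow_consistent)

text \<open>
  Commuting elements of order \<open>r\<close> generate a group \<open>Q\<close> of exponent \<open>r\<close>. By Cauchy's theorem its order is
  a power of \<open>r\<close>, hence \<open>Q\<close> is cyclic, and a cyclic group of exponent \<open>r\<close> is generated by each of
  its nontrivial elements.
\<close>

lemma (in group) commuting_same_prime_order:
  assumes fin: "finite (carrier G)" and pc: "prime_power_subgroups_cyclic G"
    and yz: "y \<in> carrier G" "z \<in> carrier G" and comm: "y \<otimes> z = z \<otimes> y"
    and r: "prime (r::nat)" and pow: "y [^] r = \<one>" "z [^] r = \<one>" and "z \<noteq> \<one>"
  obtains i :: nat where "y = z [^] i"
proof -
  define Q where "Q = {y [^] i \<otimes> z [^] j | (i::nat) (j::nat). True}"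
  have Qc: "Q \<subseteq> carrier G" using yz by (auto simp: Q_def)
  have "y [^] (0::nat) \<otimes> z [^] (1::nat) \<in> Q" "y [^] (1::nat) \<otimes> z [^] (0::nat) \<in> Q"
    unfolding Q_def by blast+
  then have yzQ: "y \<in> Q" "z \<in> Q" using yz by simp_all
  have Qr: "w [^] r = \<one>" if w: "w \<in> Q" for w
  proof -
    obtain i j :: nat where w: "w = y [^] i \<otimes> z [^] j" using w unfolding Q_def by blast
    have "w [^] r = (y [^] i) [^] r \<otimes> (z [^] j) [^] r"
      unfolding w using yz comm by (intro pow_mult_distrib commute_pow) auto
    also have "(y [^] i) [^] r = \<one>" using yz pow by (metis mult.commute nat_pow_one nat_pow_pow)
    also have "(z [^] j) [^] r = \<one>" using yz pow by (metis mult.commute nat_pow_one nat_pow_pow)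
    finally show ?thesis by simp
  qed
  have Q: "subgroup Q G"
  proof (rule subgroup_if_mult_closed[OF fin Qc])
    have "y [^] (0::nat) \<otimes> z [^] (0::nat) \<in> Q" unfolding Q_def by blast
    then show "\<one> \<in> Q" by simp
    fix v w assume "v \<in> Q" "w \<in> Q"
    then obtain i j i' j' :: nat where vw: "v = y [^] i \<otimes> z [^] j" "w = y [^] i' \<otimes> z [^] j'"
      unfolding Q_def by blast
    have "v \<otimes> w = y [^] i \<otimes> (z [^] j \<otimes> y [^] i') \<otimes> z [^] j'"
      using yz vw by (simp add: m_assoc)
    also have "z [^] j \<otimes> y [^] i' = y [^] i' \<otimes> z [^] j"
      using yz comm by (intro commute_pow) auto
    also have "y [^] i \<otimes> (y [^] i' \<otimes> z [^] j) \<otimes> z [^] j' = y [^] (i + i') \<otimes> z [^] (j + j')"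
      using yz by (simp add: m_assoc flip: nat_pow_mult)
    finally show "v \<otimes> w \<in> Q" unfolding Q_def by blast
  qed
  interpret Q: group "G\<lparr>carrier := Q\<rparr>" using Q by (rule subgroup_imp_group)
  have finQ: "finite Q" using fin Qc finite_subset by blast
  then have "card Q > 0" using yzQ by (auto simp: card_gt_0_iff)
  have "q = r" if q: "prime q" "q dvd card Q" for q
  proof -
    obtain m where "order (G\<lparr>carrier := Q\<rparr>) = q ^ 1 * m" using q(2) by (auto simp: order_def)
    then obtain R where R: "subgroup R (G\<lparr>carrier := Q\<rparr>)" "card R = q"
      using sylow_thm[OF q(1) Q.is_group, of 1 m] finQ by auto
    have "R \<subseteq> Q" and RG: "subgroup R G"
      using incl_subgroup[OF Q R(1)] subgroup.subset[OF R(1)] by simp_all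
    obtain w where w: "w \<in> R" "w \<noteq> \<one>"
    proof -
      have "\<not> R \<subseteq> {\<one>}" using R(2) prime_gt_1_nat[OF q(1)] card_mono[of "{\<one>}" R] by auto
      then show thesis using that by blast
    qed
    interpret R: group "G\<lparr>carrier := R\<rparr>" using RG by (rule subgroup_imp_group)
    have wc: "w \<in> carrier G" using w(1) \<open>R \<subseteq> Q\<close> Qc by blast
    have "w [^] q = \<one>" using R.pow_order_eq_1[of w] w(1) R(2) by (simp add: order_def flip: nat_pow_consistent)
    moreover have "w [^] r = \<one>" using Qr w(1) \<open>R \<subseteq> Q\<close> by blast
    ultimately have "ord w dvd q" "ord w dvd r" using wc by (simp_all add: pow_eq_id)
    moreover have "ord w \<noteq> 1" using w(2) wc ord_eq_1 by blast
    ultimately show "q = r" using q(1) r by (metis One_nat_def prime_nat_iff)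
  qed
  then obtain k where "card Q = r ^ k"
    using eq_prime_power_if_only_prime_divisor[OF \<open>card Q > 0\<close> r] by blast
  then obtain w where w: "w \<in> Q" "\<And>v. v \<in> Q \<Longrightarrow> \<exists>i::nat. v = w [^] i"
    using pc Q r unfolding prime_power_subgroups_cyclic_def by blast
  obtain a b :: nat where ab: "z = w [^] a" "y = w [^] b" using w(2) yzQ by blast
  have "w \<in> carrier G" using w(1) Qc by blast
  then obtain c :: nat where "w [^] b = (w [^] a) [^] c"
    using power_of_power_of_prime_order[OF r _ Qr[OF w(1)]] ab(1) \<open>z \<noteq> \<one>\<close> by metis
  then show ?thesis using that ab by simp
qed

section \<open>Transfer into the roots of unity\<close>

text \<open>
  A function \<open>f\<close> that is semi-invariant under left translations by \<open>P\<close>, with multiplier \<open>e\<close>. The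
  ratio \<open>f (t \<otimes> g) / f t\<close> then only depends on the right coset of \<open>t\<close>; multiplying these ratios
  over all cosets gives the transfer of the character \<open>e\<close>.
\<close>

locale semi_invariant_function = group G for G :: "('a, 'b) monoid_scheme" (structure) +
  fixes P :: "'a set" and e f :: "'a \<Rightarrow> complex"
  assumes finite_carrier: "finite (carrier G)"
    and subgroup_P: "subgroup P G"
    and nonzero: "t \<in> carrier G \<Longrightarrow> f t \<noteq> 0"
    and semi_invariant: "u \<in> P \<Longrightarrow> t \<in> carrier G \<Longrightarrow> f (u \<otimes> t) = e u * f t"
begin

definition ratio :: "'a \<Rightarrow> 'a set \<Rightarrow> complex"
  where "ratio g T = (let t = SOME t. t \<in> T in f (t \<otimes> g) / f t)"

definition transfer :: "'a \<Rightarrow> complex"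
  where "transfer g = (\<Prod>T\<in>rcosets P. ratio g T)"

lemma ratio_eq:
  assumes "T \<in> rcosets P" "t \<in> T" "g \<in> carrier G"
  shows "ratio g T = f (t \<otimes> g) / f t"
proof -
  define s where "s = (SOME t. t \<in> T)"
  have Pc: "P \<subseteq> carrier G" using subgroup_P by (rule subgroup.subset)
  have "s \<in> T" unfolding s_def using assms(2) by (rule someI)
  obtain a where a: "a \<in> carrier G" "T = P #> a" using assms(1) by (auto simp: RCOSETS_def)
  then have "T \<subseteq> carrier G" using Pc by (simp add: r_coset_subset_G)
  then have tc: "t \<in> carrier G" using assms by blast
  have "T = P #> t" using a assms(2) repr_independence[OF _ a(1) subgroup_P] by simp
  then obtain u where u: "u \<in> P" "s = u \<otimes> t" using \<open>s \<in> T\<close> by (auto simp: r_coset_def)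
  have uc: "u \<in> carrier G" using u(1) Pc by blast
  have "e u \<noteq> 0"
    using semi_invariant[OF u(1) tc] nonzero[of "u \<otimes> t"] uc tc by auto
  have "ratio g T = f (u \<otimes> t \<otimes> g) / f (u \<otimes> t)" by (simp add: ratio_def flip: s_def u(2))
  also have "f (u \<otimes> t \<otimes> g) = e u * f (t \<otimes> g)"
    using semi_invariant[OF u(1)] uc tc assms(3) by (simp add: m_assoc)
  also have "f (u \<otimes> t) = e u * f t" using semi_invariant[OF u(1) tc] .
  finally show ?thesis using \<open>e u \<noteq> 0\<close> by simp
qed

text \<open>
  The ratios satisfy the cocycle identity
  \<open>f (t \<otimes> g \<otimes> h) / f t = (f (t \<otimes> g) / f t) * (f (t \<otimes> g \<otimes> h) / f (t \<otimes> g))\<close>, and \<open>g\<close> permutes the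
  cosets.
\<close>

lemma transfer_mult:
  assumes g: "g \<in> carrier G" and h: "h \<in> carrier G"
  shows "transfer (g \<otimes> h) = transfer g * transfer h"
proof -
  have Pc: "P \<subseteq> carrier G" using subgroup_P by (rule subgroup.subset)
  have cos: "T \<subseteq> carrier G" "T #> b \<in> rcosets P" "(T #> a) #> b = T #> (a \<otimes> b)" "T #> \<one> = T"
    if T: "T \<in> rcosets P" and ab: "a \<in> carrier G" "b \<in> carrier G" for T a b
  proof -
    obtain c where c: "c \<in> carrier G" "T = P #> c" using T by (auto simp: RCOSETS_def)
    then show sub: "T \<subseteq> carrier G" using Pc by (simp add: r_coset_subset_G)
    show "T #> b \<in> rcosets P" using c ab Pc by (simp add: coset_mult_assoc rcosetsI)
    show "(T #> a) #> b = T #> (a \<otimes> b)" "T #> \<one> = T" using sub ab by (simp_all add: coset_mult_assoc)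
  qed
  have "ratio (g \<otimes> h) T = ratio g T * ratio h (T #> g)" if T: "T \<in> rcosets P" for T
  proof -
    obtain a where a: "a \<in> carrier G" "T = P #> a" using T by (auto simp: RCOSETS_def)
    then have "a \<in> T" using subgroup_P by (simp add: rcos_self)
    then have "a \<otimes> g \<in> T #> g" by (auto simp: r_coset_def)
    then have "ratio h (T #> g) = f (a \<otimes> g \<otimes> h) / f (a \<otimes> g)"
      using T g h a(1) cos(2) by (intro ratio_eq) auto
    moreover have "ratio g T = f (a \<otimes> g) / f a" using T \<open>a \<in> T\<close> g by (rule ratio_eq)
    moreover have "ratio (g \<otimes> h) T = f (a \<otimes> g \<otimes> h) / f a"
      using ratio_eq[OF T \<open>a \<in> T\<close>, of "g \<otimes> h"] g h a(1) by (simp add: m_assoc)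
    ultimately show ?thesis using nonzero[of "a \<otimes> g"] a(1) g by simp
  qed
  then have "transfer (g \<otimes> h) = (\<Prod>T\<in>rcosets P. ratio g T * ratio h (T #> g))"
    unfolding transfer_def by (intro prod.cong) auto
  also have "\<dots> = transfer g * (\<Prod>T\<in>rcosets P. ratio h (T #> g))"
    by (simp add: prod.distrib transfer_def)
  also have "(\<Prod>T\<in>rcosets P. ratio h (T #> g)) = transfer h"
    unfolding transfer_def
    by (rule prod.reindex_bij_witness[where i = "\<lambda>T. T #> inv g" and j = "\<lambda>T. T #> g"])
      (use cos g in simp_all)
  finally show ?thesis .
qed

lemma transfer_nonzero:
  assumes "g \<in> carrier G"
  shows "transfer g \<noteq> 0"
proof -
  have "ratio g T \<noteq> 0" if T: "T \<in> rcosets P" for T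
  proof -
    obtain a where a: "a \<in> carrier G" "T = P #> a" using T by (auto simp: RCOSETS_def)
    then have "a \<in> T" using subgroup_P by (simp add: rcos_self)
    then show ?thesis using ratio_eq[OF T _ assms] nonzero a(1) assms by simp
  qed
  moreover have "finite (rcosets P)" using finite_carrier by (simp add: RCOSETS_def)
  ultimately show ?thesis by (simp add: transfer_def)
qed

end

text \<open>
  The transfer does not depend on the choice of \<open>f\<close>, so it may be evaluated with an \<open>f\<close> that is, in
  addition, invariant under right translations by \<open>P\<close> outside a set \<open>N\<close>; later \<open>N\<close> is the normalizer of
  \<open>P\<close>. Such an \<open>f\<close> is obtained by fixing a representative \<open>d\<close> in each double coset \<open>P t P\<close> with \<open>t \<notin> N\<close>,
  and in each coset \<open>P t\<close> with \<open>t \<in> N\<close>, and by putting \<open>f (u \<otimes> d \<otimes> v) = e u\<close>, with \<open>v = \<one>\<close> in the second case. This is well defined if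
  \<open>e\<close> is trivial on \<open>P \<inter> t P t\<inverse>\<close> for \<open>t \<notin> N\<close>.
\<close>

lemma (in group) exists_semi_invariant_function:
  fixes e :: "'a \<Rightarrow> complex"
  assumes fin: "finite (carrier G)" and P: "subgroup P G"
    and e_mult: "\<And>u v. u \<in> P \<Longrightarrow> v \<in> P \<Longrightarrow> e (u \<otimes> v) = e u * e v"
    and e_nz: "\<And>u. u \<in> P \<Longrightarrow> e u \<noteq> 0"
    and N: "\<And>u v t. u \<in> P \<Longrightarrow> v \<in> P \<Longrightarrow> t \<in> carrier G \<Longrightarrow> u \<otimes> t \<otimes> v \<in> N \<longleftrightarrow> t \<in> N"
    and trivial: "\<And>t w. t \<in> carrier G - N \<Longrightarrow> w \<in> P \<Longrightarrow> conjugate (inv t) w \<in> P \<Longrightarrow> e w = 1"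
  shows "\<exists>f. semi_invariant_function G P e f \<and> (\<forall>t\<in>carrier G - N. \<forall>v\<in>P. f (t \<otimes> v) = f t)"
proof -
  interpret P: subgroup P G by fact
  have Pc: "u \<in> carrier G" if "u \<in> P" for u using that P.subset by blast
  \<comment> \<open>\<open>B t\<close> is the double coset or coset of \<open>t\<close>, and \<open>d t\<close> its representative. Since \<open>f\<close> is
    expressed through an element \<open>u\<close> that leads from \<open>t\<close> to \<open>d t\<close>, and not back, its value is
    \<open>1 / e u\<close>.\<close>
  define W where "W t = (if t \<in> N then {\<one>} else P)" for t
  define B where "B t = {u \<otimes> t \<otimes> v | u v. u \<in> P \<and> v \<in> W t}" for t
  define d where "d t = (SOME d. d \<in> B t)" for t
  define f where "f t = 1 / e (SOME u. u \<in> P \<and> (\<exists>v\<in>W t. d t = u \<otimes> t \<otimes> v))" for t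
  have WP: "W t \<subseteq> P" for t by (auto simp: W_def)
  have W_sub: "subgroup (W t) G" for t
    using P by (simp add: W_def triv_subgroup)
  have f_eq: "f t = 1 / e u"
    if t: "t \<in> carrier G" and u: "u \<in> P" and v: "v \<in> W t" and d: "d t = u \<otimes> t \<otimes> v" for t u v
  proof -
    define u1 where "u1 = (SOME u. u \<in> P \<and> (\<exists>v\<in>W t. d t = u \<otimes> t \<otimes> v))"
    have "u1 \<in> P \<and> (\<exists>v\<in>W t. d t = u1 \<otimes> t \<otimes> v)"
      unfolding u1_def by (rule someI[of _ u]) (use u v d in blast)
    then obtain v1 where u1: "u1 \<in> P" and v1: "v1 \<in> W t" "d t = u1 \<otimes> t \<otimes> v1" by blast
    note c = t Pc[OF u] Pc[OF u1] Pc[OF subsetD[OF WP v]] Pc[OF subsetD[OF WP v1(1)]]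
    have eq: "u \<otimes> t \<otimes> v = u1 \<otimes> t \<otimes> v1" using d v1(2) by simp
    have "e (inv u1 \<otimes> u) = 1"
    proof (cases "t \<in> N")
      case True
      then have "v = \<one>" "v1 = \<one>" using v v1(1) by (simp_all add: W_def)
      then have "u = u1" using eq c by simp
      moreover have "e \<one> = 1" using e_mult[of \<one> \<one>] e_nz[of \<one>] by simp
      ultimately show ?thesis using c by simp
    next
      case False
      have "conjugate (inv t) (inv u1 \<otimes> u) = v1 \<otimes> inv v"
      proof -
        have "inv t \<otimes> (inv u1 \<otimes> (u \<otimes> t \<otimes> v)) \<otimes> inv v = inv t \<otimes> (inv u1 \<otimes> (u1 \<otimes> t \<otimes> v1)) \<otimes> inv v"
          using eq by simp
        then show ?thesis using c by (simp add: m_assoc)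
      qed
      also have "v1 \<otimes> inv v \<in> P" using v v1(1) WP by blast
      finally show ?thesis using False t u u1 by (intro trivial) auto
    qed
    then have "e u1 * e (inv u1 \<otimes> u) = e u1" by simp
    moreover have "e u1 * e (inv u1 \<otimes> u) = e u"
      using u u1 c by (simp flip: e_mult)
    ultimately show ?thesis by (simp add: f_def flip: u1_def)
  qed
  have B_ne: "d t \<in> B t" if t: "t \<in> carrier G" for t
  proof -
    have "\<one> \<otimes> t \<otimes> \<one> \<in> B t"
      unfolding B_def using subgroup.one_closed[OF W_sub] P.one_closed by blast
    then show ?thesis unfolding d_def by (rule someI)
  qed
  have main: "f (u \<otimes> t \<otimes> v) = e u * f t"
    if t: "t \<in> carrier G" and u: "u \<in> P" and v: "v \<in> W t" for t u v
  proof -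
    let ?t = "u \<otimes> t \<otimes> v"
    have vP: "v \<in> P" using v WP by blast
    note c = t Pc[OF u] Pc[OF vP]
    have W: "W ?t = W t" using N[OF u vP t] by (simp add: W_def)
    have B: "B ?t = B t"
    proof (intro equalityI subsetI)
      fix s assume "s \<in> B ?t"
      then obtain a b where ab: "a \<in> P" "b \<in> W t" "s = a \<otimes> ?t \<otimes> b" by (auto simp: B_def W)
      note ab_c = Pc[OF ab(1)] Pc[OF subsetD[OF WP ab(2)]]
      have "s = (a \<otimes> u) \<otimes> t \<otimes> (v \<otimes> b)" using ab(3) ab_c c by (simp add: m_assoc)
      then show "s \<in> B t"
        unfolding B_def using ab u v subgroup.m_closed[OF W_sub] by blast
    next
      fix s assume "s \<in> B t"
      then obtain a b where ab: "a \<in> P" "b \<in> W t" "s = a \<otimes> t \<otimes> b" by (auto simp: B_def)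
      note ab_c = Pc[OF ab(1)] Pc[OF subsetD[OF WP ab(2)]]
      have "s = (a \<otimes> inv u) \<otimes> ?t \<otimes> (inv v \<otimes> b)" using ab(3) ab_c c by (simp add: m_assoc)
      moreover have "a \<otimes> inv u \<in> P" "inv v \<otimes> b \<in> W ?t"
        using ab u v W subgroup.m_closed[OF W_sub] subgroup.m_inv_closed[OF W_sub] by auto
      ultimately show "s \<in> B ?t" unfolding B_def by blast
    qed
    then have d_eq: "d ?t = d t" by (simp add: d_def)
    obtain a b where ab: "a \<in> P" "b \<in> W ?t" "d ?t = a \<otimes> ?t \<otimes> b"
      using B_ne[of ?t] c by (auto simp: B_def)
    note ab_c = Pc[OF ab(1)] Pc[OF subsetD[OF WP ab(2)]]
    have "f ?t = 1 / e a" using ab c by (intro f_eq) auto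
    moreover have "f t = 1 / e (a \<otimes> u)"
    proof (rule f_eq)
      show "v \<otimes> b \<in> W t" using v ab(2) W subgroup.m_closed[OF W_sub] by simp
      show "d t = a \<otimes> u \<otimes> t \<otimes> (v \<otimes> b)" using d_eq ab(3) ab_c c by (simp add: m_assoc)
    qed (use t u ab in auto)
    ultimately show ?thesis using e_mult[OF ab(1) u] e_nz[OF u] by simp
  qed
  show ?thesis
  proof (intro exI[of _ f] conjI ballI)
    show "semi_invariant_function G P e f"
    proof (unfold_locales)
      fix t assume t: "t \<in> carrier G"
      obtain a b where ab: "a \<in> P" "b \<in> W t" "d t = a \<otimes> t \<otimes> b"
        using B_ne[of t] t by (auto simp: B_def)
      then show "f t \<noteq> 0" using f_eq[OF t ab] e_nz by simp
    next
      fix u t assume ut: "u \<in> P" "t \<in> carrier G"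
      then show "f (u \<otimes> t) = e u * f t"
        using main[of t u \<one>] subgroup.one_closed[OF W_sub] Pc by simp
    qed (use fin P in auto)
    fix t v assume tv: "t \<in> carrier G - N" "v \<in> P"
    moreover have "e \<one> = 1" using e_mult[of \<one> \<one>] e_nz[of \<one>] by simp
    ultimately show "f (t \<otimes> v) = f t" using main[of t \<one> v] by (simp add: W_def)
  qed
qed

lemma (in group) conj_eq_pow_iterate:
  assumes "g \<in> carrier G" "x \<in> carrier G" and "conjugate g x = x [^] (k::nat)"
  shows "conjugate (g [^] (n::nat)) x = x [^] (k ^ n)"
proof (induction n)
  case (Suc n)
  have "conjugate (g [^] Suc n) x = conjugate (g [^] n) (conjugate g x)"
    using assms(1,2) by (simp add: conj_conj)
  also have "\<dots> = conjugate (g [^] n) x [^] k"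
    using assms by (simp only: assms(3) conj_pow nat_pow_closed)
  also have "\<dots> = x [^] (k ^ Suc n)"
    using assms Suc by (simp add: nat_pow_pow mult.commute)
  finally show ?case .
qed (use assms in simp)

lemma (in group) conj_exponent_cong_1:
  assumes "g \<in> carrier G" "x \<in> carrier G" and conj: "conjugate g x = x [^] (k::nat)"
    and p: "prime p" "p dvd ord x" and n: "g [^] (n::nat) = \<one>" "n > 0" "coprime n (p - 1)"
  shows "[k = 1] (mod p)"
proof (rule cong_1_if_power_cong_1[OF p(1) _ n(2,3)])
  have "x [^] (k ^ n) = x [^] (1::nat)"
    using conj_eq_pow_iterate[OF assms(1-3), of n] n(1) assms(2) by simp
  then have "[k ^ n = 1] (mod ord x)" using assms(2) by (rule cong_if_pow_eq_pow[rotated])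
  then show "[k ^ n = 1] (mod p)" using p(2) by (rule cong_dvd_modulus_nat)
qed

lemma root_of_unity_power_cong:
  fixes \<zeta> :: complex
  assumes "\<zeta> ^ p = 1" and "[i = j] (mod p)"
  shows "\<zeta> ^ i = \<zeta> ^ j"
proof -
  have "\<zeta> ^ n = \<zeta> ^ (n mod p)" for n
  proof -
    have "\<zeta> ^ n = \<zeta> ^ (p * (n div p) + n mod p)" by simp
    then show ?thesis using assms(1) by (simp only: power_add power_mult power_one mult_1)
  qed
  then show ?thesis using assms(2) unfolding cong_def by metis
qed

lemma exists_primitive_prime_root_of_unity:
  assumes "prime p"
  obtains \<zeta> :: complex where "\<And>n. \<zeta> ^ n = 1 \<longleftrightarrow> p dvd n"
proof -
  have "\<not> {z::complex. z ^ p = 1} \<subseteq> {1}"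
  proof
    assume "{z::complex. z ^ p = 1} \<subseteq> {1}"
    then have "card {z::complex. z ^ p = 1} \<le> card {1::complex}" by (intro card_mono) auto
    then show False using card_roots_unity_eq[of p] prime_gt_1_nat[OF assms] by simp
  qed
  then obtain \<zeta> :: complex where \<zeta>: "\<zeta> ^ p = 1" "\<zeta> \<noteq> 1" by blast
  have "\<zeta> ^ n = 1 \<longleftrightarrow> p dvd n" for n
  proof
    assume n: "\<zeta> ^ n = 1"
    show "p dvd n"
    proof (rule ccontr)
      assume "\<not> p dvd n"
      then obtain c where "[n * c = 1] (mod p)" using obtain_inverse_mod_prime assms by blast
      with \<zeta>(1) have "\<zeta> ^ (n * c) = \<zeta> ^ 1" by (rule root_of_unity_power_cong)
      then show False using n \<zeta>(2) by (simp add: power_mult)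
    qed
  qed (use \<zeta> in \<open>auto simp: power_mult\<close>)
  then show ?thesis using that by blast
qed

text \<open>
  Let \<open>e\<close> be the character of \<open>P\<close> of order \<open>p\<close> that maps the generator \<open>x\<close> to a primitive \<open>p\<close>-th root of
  unity \<open>\<zeta>\<close>, and take its transfer. With \<open>f\<close> as in the previous lemma, a coset outside the normalizer
  \<open>N\<close> of \<open>P\<close> contributes the factor 1 to the value at \<open>x\<close>. A coset of some \<open>t \<in> N\<close> contributes
  \<open>e (t x t\<inverse>)\<close>, which is \<open>\<zeta>\<close>: as \<open>p\<close> is the smallest prime divisor of the group order, the order of \<open>t\<close>
  is prime to \<open>p - 1\<close>, so \<open>t\<close> acts trivially on the quotient of \<open>P\<close> of order \<open>p\<close>. Hence \<open>x\<close> is mapped to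
  \<open>\<zeta>\<close> to the power \<open>|N : P|\<close>, and this index is prime to \<open>p\<close>.
\<close>

lemma (in group) exists_nontrivial_character:
  assumes fin: "finite (carrier G)" and p: "prime p" "p dvd order G"
    and least: "\<And>q. prime q \<Longrightarrow> q dvd order G \<Longrightarrow> p \<le> q"
    and P: "subgroup P G" "card P = p ^ a" "\<not> p dvd card (rcosets P)"
    and x: "x \<in> P" and gen: "\<And>y. y \<in> P \<Longrightarrow> \<exists>i::nat. y = x [^] i"
  obtains \<chi> :: "'a \<Rightarrow> complex"
  where "\<And>g h. g \<in> carrier G \<Longrightarrow> h \<in> carrier G \<Longrightarrow> \<chi> (g \<otimes> h) = \<chi> g * \<chi> h"
    and "\<And>g. g \<in> carrier G \<Longrightarrow> \<chi> g \<noteq> 0" and "\<chi> x \<noteq> 1"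
proof -
  interpret P: subgroup P G by (rule P(1))
  have Pc: "u \<in> carrier G" if "u \<in> P" for u using that P.subset by blast
  have xc: "x \<in> carrier G" using x Pc by blast
  have powP: "x [^] (i::nat) \<in> P" for i using subgroup_nat_pow_closed[OF P(1) x] .
  have "ord x dvd p ^ a"
    using group.pow_order_eq_1[OF subgroup_imp_group[OF P(1)], of x] x xc P(2)
    by (simp add: order_def pow_eq_id flip: nat_pow_consistent)
  then obtain b where b: "ord x = p ^ b" using p(1) by (auto simp: divides_primepow_nat)
  have p_ord: "p dvd ord x"
  proof -
    have "p dvd card (rcosets P) * card P" using p(2) lagrange[OF P(1)] by simp
    then have "p dvd card P" using p(1) P(3) by (simp add: prime_dvd_mult_iff)
    moreover have "card P > 0" using P(2) p(1) by (simp add: prime_gt_0_nat)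
    ultimately have "card P \<ge> p" by (simp add: dvd_imp_le)
    then have "\<not> P \<subseteq> {\<one>}" using prime_gt_1_nat[OF p(1)] card_mono[of "{\<one>}" P] by auto
    then obtain y where "y \<in> P" "y \<noteq> \<one>" by blast
    then have "x \<noteq> \<one>" using gen[of y] nat_pow_one by blast
    then have "ord x \<noteq> 1" using ord_eq_1 xc by blast
    then show ?thesis using b by (cases b) auto
  qed
  obtain \<zeta> :: complex where \<zeta>: "\<And>n. \<zeta> ^ n = 1 \<longleftrightarrow> p dvd n"
    using exists_primitive_prime_root_of_unity[OF p(1)] by blast
  have \<zeta>_cong: "\<zeta> ^ i = \<zeta> ^ j" if "[i = j] (mod p)" for i j
    using that by (rule root_of_unity_power_cong[rotated]) (simp add: \<zeta>)
  define e where "e u = \<zeta> ^ (SOME i::nat. u = x [^] i)" for u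
  have e: "e (x [^] i) = \<zeta> ^ i" for i :: nat
  proof -
    have "x [^] i = x [^] (SOME j::nat. x [^] i = x [^] j)" by (rule someI) (rule refl)
    then have "[i = (SOME j::nat. x [^] i = x [^] j)] (mod ord x)" by (rule cong_if_pow_eq_pow[OF xc])
    then have "[i = (SOME j::nat. x [^] i = x [^] j)] (mod p)" using p_ord by (rule cong_dvd_modulus_nat)
    then show ?thesis using \<zeta>_cong e_def by simp
  qed
  define N where "N = {t \<in> carrier G. \<forall>u\<in>P. conjugate t u \<in> P}"
  have N_conj: "conjugate t u \<in> P" if "t \<in> N" "u \<in> P" for t u
    using that unfolding N_def by blast
  have NG: "subgroup N G"
  proof (rule subgroup_if_mult_closed[OF fin])
    fix s t assume st: "s \<in> N" "t \<in> N"
    then have c: "s \<in> carrier G" "t \<in> carrier G" by (simp_all add: N_def)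
    have "conjugate (s \<otimes> t) u \<in> P" if u: "u \<in> P" for u
    proof -
      have "conjugate s (conjugate t u) \<in> P" using st u unfolding N_def by blast
      then show ?thesis using conj_conj[OF c Pc[OF u]] by simp
    qed
    with c show "s \<otimes> t \<in> N" unfolding N_def by (intro CollectI conjI ballI m_closed)
  next
    show "\<one> \<in> N" unfolding N_def using Pc by simp
    show "N \<subseteq> carrier G" unfolding N_def by blast
  qed
  interpret N: subgroup N G by (rule NG)
  have PN: "P \<subseteq> N"
  proof
    fix v assume v: "v \<in> P"
    then have "conjugate v u \<in> P" if "u \<in> P" for u
      using that by (intro P.m_closed P.m_inv_closed)
    with Pc[OF v] show "v \<in> N" unfolding N_def by blast
  qed
  have N_if_gen: "t \<in> N" if t: "t \<in> carrier G" and cx: "conjugate t x \<in> P" for t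
    unfolding N_def
  proof (intro CollectI conjI ballI t)
    fix u assume "u \<in> P"
    then obtain i :: nat where "u = x [^] i" using gen by blast
    then show "conjugate t u \<in> P"
      using subgroup_nat_pow_closed[OF P(1) cx] by (simp add: conj_pow t xc)
  qed
  have N_trans: "u \<otimes> t \<otimes> v \<in> N \<longleftrightarrow> t \<in> N" if uv: "u \<in> P" "v \<in> P" and t: "t \<in> carrier G" for u v t
  proof
    assume utv: "u \<otimes> t \<otimes> v \<in> N"
    have "inv u \<in> N" "inv v \<in> N"
      using N.m_inv_closed[OF subsetD[OF PN uv(1)]] N.m_inv_closed[OF subsetD[OF PN uv(2)]] .
    then have "inv u \<otimes> (u \<otimes> t \<otimes> v) \<otimes> inv v \<in> N"
      using N.m_closed[OF N.m_closed[OF _ utv]] by blast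
    then show "t \<in> N" using t Pc[OF uv(1)] Pc[OF uv(2)] by (simp add: m_assoc)
  next
    assume "t \<in> N"
    then show "u \<otimes> t \<otimes> v \<in> N"
      using subsetD[OF PN uv(1)] subsetD[OF PN uv(2)] by (intro N.m_closed)
  qed
  \<comment> \<open>If \<open>e w \<noteq> 1\<close>, then \<open>w\<close> generates \<open>P\<close>, so \<open>t\<inverse> w t \<in> P\<close> forces \<open>t\<inverse>\<close> to normalize \<open>P\<close>.\<close>
  have trivial: "e w = 1"
    if t: "t \<in> carrier G - N" and w: "w \<in> P" and conj_w: "conjugate (inv t) w \<in> P" for t w
  proof (rule ccontr)
    assume "e w \<noteq> 1"
    obtain i :: nat where i: "w = x [^] i" using gen w by blast
    have "\<not> p dvd i" using \<open>e w \<noteq> 1\<close> i e \<zeta> by simp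
    then have "coprime i (ord x)" using p(1) b
      by (metis coprime_commute coprime_power_left_iff prime_imp_coprime)
    then obtain j where "[i * j = 1] (mod ord x)" using cong_solve_coprime_nat by force
    then have "x = w [^] j" using pow_eq_pow_if_cong[of x "i * j" 1] i xc by (simp add: nat_pow_pow)
    then have "conjugate (inv t) x = conjugate (inv t) w [^] j"
      using t conj_pow[of "inv t" w j] Pc[OF w] by simp
    then have "conjugate (inv t) x \<in> P" using subgroup_nat_pow_closed[OF P(1) conj_w] by simp
    then have "inv t \<in> N" using t by (intro N_if_gen) auto
    then have "inv (inv t) \<in> N" by blast
    then show False using t by simp
  qed
  have e_mult: "e (u \<otimes> v) = e u * e v" if uv: "u \<in> P" "v \<in> P" for u v
  proof -
    obtain i j :: nat where "u = x [^] i" "v = x [^] j" using gen[OF uv(1)] gen[OF uv(2)] by blast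
    then show ?thesis by (simp add: nat_pow_mult xc e power_add)
  qed
  have e_nz: "e u \<noteq> 0" if u: "u \<in> P" for u
  proof -
    have "\<zeta> \<noteq> 0" using \<zeta>[of p] prime_gt_0_nat[OF p(1)] by (auto simp: power_0_left)
    then show ?thesis by (simp add: e_def)
  qed
  have "\<exists>f. semi_invariant_function G P e f \<and> (\<forall>t\<in>carrier G - N. \<forall>v\<in>P. f (t \<otimes> v) = f t)"
    by (rule exists_semi_invariant_function[OF fin P(1)]) (fact e_mult e_nz N_trans trivial)+
  then obtain f where f: "semi_invariant_function G P e f"
    and f_right: "\<forall>t\<in>carrier G - N. \<forall>v\<in>P. f (t \<otimes> v) = f t"
    by (elim exE conjE)
  interpret semi_invariant_function G P e f by (rule f)
  have coset_N: "P #> t \<subseteq> N" if t: "t \<in> N" for t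
  proof
    fix s assume "s \<in> P #> t"
    then obtain u where u: "u \<in> P" "s = u \<otimes> t" unfolding r_coset_def by blast
    show "s \<in> N" unfolding u(2) using subsetD[OF PN u(1)] t by (rule N.m_closed)
  qed
  have ratio: "ratio x T = (if T \<subseteq> N then \<zeta> else 1)" if T: "T \<in> rcosets P" for T
  proof -
    obtain t where t: "t \<in> carrier G" "T = P #> t" using T by (auto simp: RCOSETS_def)
    then have tT: "t \<in> T" using P(1) by (simp add: rcos_self)
    have ratio_t: "ratio x T = f (t \<otimes> x) / f t" using T tT xc by (rule ratio_eq)
    have T_N: "T \<subseteq> N \<longleftrightarrow> t \<in> N" unfolding t(2)
      using subsetD[of T N t] tT t(2) coset_N[of t] by blast
    show ?thesis
    proof (cases "t \<in> N")
      case True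
      obtain k :: nat where k: "conjugate t x = x [^] k" using gen[OF N_conj[OF True x]] by (elim exE)
      have "order G > 0" using fin by (simp add: order_gt_0_iff_finite)
      then have "[k = 1] (mod p)"
        using coprime_minus_1_if_least_prime[OF p(1) least] pow_order_eq_1[OF t(1)]
        by (intro conj_exponent_cong_1[OF t(1) xc k p(1) p_ord]) auto
      then have "e (x [^] k) = \<zeta>" using e \<zeta>_cong[of k 1] by simp
      moreover have "t \<otimes> x = x [^] k \<otimes> t" using t(1) xc by (simp add: m_assoc flip: k)
      ultimately have "f (t \<otimes> x) = \<zeta> * f t" using semi_invariant[OF powP t(1)] by simp
      then show ?thesis using ratio_t nonzero[OF t(1)] True T_N by simp
    next
      case False
      then show ?thesis using ratio_t nonzero[OF t(1)] f_right t(1) x T_N by simp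
    qed
  qed
  define c where "c = card {T \<in> rcosets P. T \<subseteq> N}"
  have "transfer x = (\<Prod>T\<in>rcosets P. if T \<subseteq> N then \<zeta> else 1)"
    using ratio by (simp add: transfer_def)
  also have "\<dots> = \<zeta> ^ c"
    using fin by (simp add: c_def RCOSETS_def flip: prod.inter_filter)
  finally have "transfer x = \<zeta> ^ c" .
  moreover have "\<not> p dvd c"
  proof -
    have "{T \<in> rcosets P. T \<subseteq> N} = rcosets\<^bsub>G\<lparr>carrier := N\<rparr>\<^esub> P"
    proof (intro equalityI subsetI)
      fix T assume T: "T \<in> {T \<in> rcosets P. T \<subseteq> N}"
      then obtain t where t: "t \<in> carrier G" "T = P #> t" by (auto simp: RCOSETS_def)
      then have "t \<in> N" using T rcos_self[OF t(1) P(1)] by blast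
      then show "T \<in> rcosets\<^bsub>G\<lparr>carrier := N\<rparr>\<^esub> P" using t(2) by (simp add: RCOSETS_def) blast
    next
      fix T assume "T \<in> rcosets\<^bsub>G\<lparr>carrier := N\<rparr>\<^esub> P"
      then obtain t where t: "t \<in> N" "T = P #> t" by (auto simp: RCOSETS_def)
      then have "t \<in> carrier G" by (rule_tac N.mem_carrier)
      then have "T \<in> rcosets P" unfolding t(2) using P.subset by (rule rcosetsI[rotated])
      then show "T \<in> {T \<in> rcosets P. T \<subseteq> N}" using coset_N[OF t(1)] t(2) by blast
    qed
    moreover have "subgroup P (G\<lparr>carrier := N\<rparr>)" using P(1) NG PN by (rule subgroup_incl)
    ultimately have "c * card P = card N"
      using group.lagrange[OF subgroup_imp_group[OF NG], of P] by (simp add: c_def order_def)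
    then have "card (rcosets N) * c * card P = card (rcosets P) * card P"
      using lagrange[OF NG] lagrange[OF P(1)] by (simp add: mult.assoc)
    then have "card (rcosets N) * c = card (rcosets P)" using P(2) p(1) by (simp add: prime_gt_0_nat)
    then show ?thesis using P(3) by (metis dvd_mult)
  qed
  ultimately have "transfer x \<noteq> 1" using \<zeta> by simp
  with transfer_mult transfer_nonzero show ?thesis by (rule that)
qed

section \<open>A normal subgroup of prime order\<close>

text \<open>
  The kernel \<open>M\<close> of a nontrivial character is a proper normal subgroup. If it is trivial, then the group
  is abelian. Otherwise, by induction, \<open>M\<close> has a normal subgroup \<open>\<langle>z\<rangle>\<close> of prime order \<open>r\<close>, and this is
  the only subgroup of order \<open>r\<close> of \<open>M\<close>: an element \<open>y\<close> of order \<open>r\<close> normalizes \<open>\<langle>z\<rangle>\<close>, hence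
  centralizes it because \<open>r\<close> is prime to \<open>r - 1\<close>, and thus is a power of \<open>z\<close>. Therefore \<open>\<langle>z\<rangle>\<close> is even
  normalized by the whole group.
\<close>

lemma exists_normal_prime_order_subgroup:
  fixes G (structure)
  assumes "group G" "finite (carrier G)" "prime_power_subgroups_cyclic G" "carrier G \<noteq> {\<one>}"
  shows "\<exists>z\<in>carrier G. \<exists>r::nat. prime r \<and> z \<noteq> \<one> \<and> z [^] r = \<one> \<and>
    (\<forall>g\<in>carrier G. \<exists>i::nat. g \<otimes> z \<otimes> inv g = z [^] i)"
  using assms
proof (induction "card (carrier G)" arbitrary: G rule: less_induct)
  case less
  interpret group G by (rule less.prems(1))
  note fin = less.prems(2) and pc = less.prems(3)
  have "order G \<noteq> 1" using less.prems(4) order_one_triv_iff by simp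
  define p where "p = (LEAST p. prime p \<and> p dvd order G)"
  have p: "prime p" "p dvd order G"
  proof -
    obtain q where "prime q \<and> q dvd order G" using prime_factor_nat \<open>order G \<noteq> 1\<close> by blast
    then have "prime p \<and> p dvd order G" unfolding p_def by (rule LeastI)
    then show "prime p" "p dvd order G" by blast+
  qed
  have least: "p \<le> q" if "prime q" "q dvd order G" for q
    unfolding p_def using that by (intro Least_le) blast
  obtain P where P: "sylow_subgroup p P G" "\<not> p dvd card (rcosets\<^bsub>G\<^esub> P)"
    using obtain_sylow_subgroup[OF fin p(1)] by blast
  then have PG: "subgroup P G" and card_P: "card P = p ^ multiplicity p (order G)"
    by (simp_all add: sylow_subgroup_def)
  obtain x where x: "x \<in> P" "\<And>y. y \<in> P \<Longrightarrow> \<exists>i::nat. y = x [^]\<^bsub>G\<^esub> i"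
    using pc p(1) PG card_P unfolding prime_power_subgroups_cyclic_def by blast
  obtain \<chi> :: "_ \<Rightarrow> complex"
    where mult: "\<And>g h. g \<in> carrier G \<Longrightarrow> h \<in> carrier G \<Longrightarrow> \<chi> (g \<otimes>\<^bsub>G\<^esub> h) = \<chi> g * \<chi> h"
    and nz: "\<And>g. g \<in> carrier G \<Longrightarrow> \<chi> g \<noteq> 0" and "\<chi> x \<noteq> 1"
    using exists_nontrivial_character[OF fin p least PG card_P P(2) x] by blast
  define M where "M = {g \<in> carrier G. \<chi> g = 1}"
  have \<chi>_one: "\<chi> \<one>\<^bsub>G\<^esub> = 1" using mult[of "\<one>\<^bsub>G\<^esub>" "\<one>\<^bsub>G\<^esub>"] nz[of "\<one>\<^bsub>G\<^esub>"] by simp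
  have \<chi>_conj: "\<chi> (conjugate g h) = \<chi> h" if gh: "g \<in> carrier G" "h \<in> carrier G" for g h
  proof -
    have "\<chi> g * \<chi> (inv\<^bsub>G\<^esub> g) = 1" using gh \<chi>_one by (simp flip: mult)
    then show ?thesis using gh by (simp add: mult mult.commute)
  qed
  have MG: "subgroup M G"
  proof (rule subgroup_if_mult_closed[OF fin])
    fix g h assume "g \<in> M" "h \<in> M"
    then show "g \<otimes>\<^bsub>G\<^esub> h \<in> M" by (simp add: M_def mult)
  qed (simp_all add: M_def \<chi>_one Collect_restrict)
  show ?case
  proof (cases "M = {\<one>\<^bsub>G\<^esub>}")
    case True
    have comm: "conjugate g h = h" if gh: "g \<in> carrier G" "h \<in> carrier G" for g h
    proof -
      have "\<chi> (conjugate g h \<otimes>\<^bsub>G\<^esub> inv\<^bsub>G\<^esub> h) = \<chi> (h \<otimes>\<^bsub>G\<^esub> inv\<^bsub>G\<^esub> h)"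
        using gh \<chi>_conj[OF gh] by (simp only: mult m_closed inv_closed)
      then have "conjugate g h \<otimes>\<^bsub>G\<^esub> inv\<^bsub>G\<^esub> h \<in> M" using gh \<chi>_one by (simp add: M_def)
      then have "conjugate g h \<otimes>\<^bsub>G\<^esub> inv\<^bsub>G\<^esub> h = \<one>\<^bsub>G\<^esub>" using True by blast
      then show ?thesis using gh by (metis inv_closed inv_equality inv_inv m_closed)
    qed
    obtain y where y: "y \<in> carrier G" "y \<noteq> \<one>\<^bsub>G\<^esub>" using less.prems(4) one_closed by blast
    then obtain k :: nat where k: "prime (group.ord G (y [^]\<^bsub>G\<^esub> k))" "y [^]\<^bsub>G\<^esub> k \<noteq> \<one>\<^bsub>G\<^esub>"
      using obtain_prime_order_power[OF fin] by blast
    let ?z = "y [^]\<^bsub>G\<^esub> k"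
    have z: "?z \<in> carrier G" using y by simp
    moreover have "\<exists>i::nat. conjugate g ?z = ?z [^]\<^bsub>G\<^esub> i" if "g \<in> carrier G" for g
      using comm[OF that z] z by (intro exI[of _ 1]) simp
    ultimately show ?thesis using k pow_ord_eq_1[OF z] by blast
  next
    case False
    let ?M = "G\<lparr>carrier := M\<rparr>"
    have "x \<in> carrier G" using x(1) PG by (rule subgroup.mem_carrier[rotated])
    then have "M \<subset> carrier G" using \<open>\<chi> x \<noteq> 1\<close> by (auto simp: M_def)
    then have "card (carrier ?M) < card (carrier G)" using fin by (simp add: psubset_card_mono)
    moreover have "finite (carrier ?M)" using \<open>M \<subset> carrier G\<close> fin finite_subset by auto
    ultimately have "\<exists>z\<in>carrier ?M. \<exists>r::nat. prime r \<and> z \<noteq> \<one>\<^bsub>?M\<^esub> \<and> z [^]\<^bsub>?M\<^esub> r = \<one>\<^bsub>?M\<^esub> \<and>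
        (\<forall>g\<in>carrier ?M. \<exists>i::nat. g \<otimes>\<^bsub>?M\<^esub> z \<otimes>\<^bsub>?M\<^esub> inv\<^bsub>?M\<^esub> g = z [^]\<^bsub>?M\<^esub> i)"
      using subgroup_imp_group[OF MG] prime_power_subgroups_cyclic_subgroup[OF pc MG] False
      by (intro less.hyps) simp_all
    then obtain z and r :: nat where z: "z \<in> M" and r: "prime r" "z \<noteq> \<one>\<^bsub>G\<^esub>" "z [^]\<^bsub>G\<^esub> r = \<one>\<^bsub>G\<^esub>"
      and norm: "\<And>g. g \<in> M \<Longrightarrow> \<exists>i::nat. conjugate g z = z [^]\<^bsub>G\<^esub> i"
      using m_inv_consistent[OF MG] by (auto simp flip: nat_pow_consistent)
    have zc: "z \<in> carrier G" using z by (simp add: M_def)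
    have "\<exists>i::nat. conjugate g z = z [^]\<^bsub>G\<^esub> i" if g: "g \<in> carrier G" for g
    proof -
      define y where "y = conjugate g z"
      have y: "y \<in> M" using z \<chi>_conj[OF g zc] g zc by (simp add: M_def y_def)
      then have yc: "y \<in> carrier G" by (simp add: M_def)
      have y_pow: "y [^]\<^bsub>G\<^esub> r = \<one>\<^bsub>G\<^esub>"
        using conj_pow[OF g zc, of r] r(3) g by (simp add: y_def)
      obtain k :: nat where k: "conjugate y z = z [^]\<^bsub>G\<^esub> k" using norm[OF y] by blast
      have "group.ord G z dvd r" "group.ord G z \<noteq> 1"
        using r zc pow_eq_id ord_eq_1 by auto
      then have ord_z: "group.ord G z = r" using r(1) by (metis One_nat_def prime_nat_iff)
      have "coprime r (r - 1)"
        using prime_gt_1_nat[OF r(1)] by (metis coprime_commute coprime_diff_one_left_nat less_trans zero_less_one)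
      then have "[k = 1] (mod r)"
        using r(1) ord_z y_pow prime_gt_0_nat[OF r(1)]
        by (intro conj_exponent_cong_1[OF yc zc k]) auto
      then have "z [^]\<^bsub>G\<^esub> k = z [^]\<^bsub>G\<^esub> (1::nat)" using ord_z by (intro pow_eq_pow_if_cong zc) simp
      then have "conjugate y z = z" using k zc by simp
      then have "y \<otimes>\<^bsub>G\<^esub> z = z \<otimes>\<^bsub>G\<^esub> y" using conj_eq_self_iff yc zc by blast
      then obtain i :: nat where "y = z [^]\<^bsub>G\<^esub> i"
        using commuting_same_prime_order[OF fin pc yc zc _ r(1) y_pow r(3,2)] by blast
      then show ?thesis unfolding y_def by blast
    qed
    then show ?thesis using zc r by blast
  qed
qed

section \<open>The cyclic graph\<close>

lemma disconnectedD:
  assumes "finite (carrier G)" "disconnected (with_proj (cyclic_graph G))"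
    and z: "z \<in> carrier G - {\<one>\<^bsub>G\<^esub>}"
  obtains x where "x \<in> carrier G - {\<one>\<^bsub>G\<^esub>}" "\<not> z \<rightarrow>\<^sup>*\<^bsub>with_proj (cyclic_graph G)\<^esub> x"
proof -
  interpret pair_graph "cyclic_graph G" using assms(1) by (rule pair_graph_cyclic_graph)
  obtain u v where "u \<in> carrier G - {\<one>\<^bsub>G\<^esub>}" "v \<in> carrier G - {\<one>\<^bsub>G\<^esub>}"
    and "\<not> u \<rightarrow>\<^sup>*\<^bsub>with_proj (cyclic_graph G)\<^esub> v"
    using assms(2) unfolding disconnected_def by (auto simp: cyclic_graph_def)
  then show ?thesis using that symmetric_reachable'[of z u] reachable_trans[of u z v] by blast
qed

context group
begin

lemma commute_if_adjacent:
  assumes "(x, y) \<in> parcs (cyclic_graph G)"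
  shows "x \<otimes> y = y \<otimes> x"
proof -
  let ?H = "subgroup_generated G {x, y}"
  have xy: "x \<in> carrier G" "y \<in> carrier G" and "cyclic_group ?H"
    using assms by (auto simp: cyclic_graph_def)
  then interpret H: comm_group ?H by (intro group.cyclic_imp_abelian_group) simp_all
  have "{x, y} \<subseteq> carrier ?H" using xy by (intro subgroup_generated_subset_carrier_subset) simp
  then show ?thesis using H.m_comm[of x y] by simp
qed

lemma reachable_if_powers:
  assumes fin: "finite (carrier G)"
    and xy: "x \<in> carrier G - {\<one>}" "y \<in> carrier G - {\<one>}"
    and w: "w \<in> generate G {x, y}" and pow: "x = w [^] (i::nat)" "y = w [^] (j::nat)"
  shows "x \<rightarrow>\<^sup>*\<^bsub>with_proj (cyclic_graph G)\<^esub> y"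
proof -
  interpret pair_graph "cyclic_graph G" using fin by (rule pair_graph_cyclic_graph)
  show ?thesis
  proof (cases "x = y")
    case True
    moreover have "x \<in> pverts (cyclic_graph G)" using xy(1) by (simp add: cyclic_graph_def)
    ultimately show ?thesis using reachable_refl by blast
  next
    case False
    have sub: "{x, y} \<subseteq> carrier G" using xy by blast
    then have wc: "w \<in> carrier G" using w generate_in_carrier by blast
    have "subgroup (generate G {w}) G" using wc by (intro generate_is_subgroup) simp
    moreover have "w \<in> generate G {w}" by (simp add: generate.incl)
    ultimately have "{x, y} \<subseteq> generate G {w}"
      unfolding pow by (simp add: subgroup_nat_pow_closed)
    then have "generate G {x, y} = generate G {w}"
      using wc w sub by (intro equalityI generate_subgroup_incl generate_is_subgroup) auto
    then have "subgroup_generated G {x, y} = subgroup_generated G {w}"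
      using sub wc by (simp add: subgroup_generated_def Int_absorb1)
    then have "cyclic_group (subgroup_generated G {x, y})" by (simp add: cyclic_group_generated)
    then have "(x, y) \<in> parcs (cyclic_graph G)" using xy False by (simp add: cyclic_graph_def)
    then show ?thesis by simp
  qed
qed

lemma reachable_power:
  assumes "finite (carrier G)" and x: "x \<in> carrier G" and "x [^] (k::nat) \<noteq> \<one>"
  shows "x \<rightarrow>\<^sup>*\<^bsub>with_proj (cyclic_graph G)\<^esub> (x [^] k)"
proof (rule reachable_if_powers[where w = x])
  have "x \<noteq> \<one>" using assms(3) by auto
  then show "x \<in> carrier G - {\<one>}" using x by simp
  show "x \<in> generate G {x, x [^] k}" by (simp add: generate.incl)
  show "x = x [^] (1::nat)" using x by simp
qed (use assms in auto)

text \<open>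
  Every nontrivial element is joined to a power of itself of prime order. Two commuting elements of
  prime orders \<open>p \<noteq> q\<close> are both powers of their product. For \<open>p = q\<close> they are powers of each other, because they
  generate a \<open>p\<close>-group, which is cyclic.
\<close>

lemma reachable_if_commute:
  assumes fin: "finite (carrier G)" and pc: "prime_power_subgroups_cyclic G"
    and x: "x \<in> carrier G - {\<one>}" and y: "y \<in> carrier G - {\<one>}" and comm: "x \<otimes> y = y \<otimes> x"
  shows "x \<rightarrow>\<^sup>*\<^bsub>with_proj (cyclic_graph G)\<^esub> y"
proof -
  interpret pair_graph "cyclic_graph G" using fin by (rule pair_graph_cyclic_graph)
  obtain k :: nat where k: "prime (ord (x [^] k))" "x [^] k \<noteq> \<one>"
    using obtain_prime_order_power[OF fin] x by blast
  obtain l :: nat where l: "prime (ord (y [^] l))" "y [^] l \<noteq> \<one>"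
    using obtain_prime_order_power[OF fin] y by blast
  define x' y' p q where "x' = x [^] k" and "y' = y [^] l" and "p = ord x'" and "q = ord y'"
  have x': "x' \<in> carrier G" "x' \<noteq> \<one>" "prime p" "x' [^] p = \<one>"
    and y': "y' \<in> carrier G" "y' \<noteq> \<one>" "prime q" "y' [^] q = \<one>"
    using x y k l by (simp_all add: x'_def y'_def p_def q_def)
  have comm': "x' \<otimes> y' = y' \<otimes> x'"
    unfolding x'_def y'_def using x y comm by (intro commute_pow) auto
  have "x' \<rightarrow>\<^sup>*\<^bsub>with_proj (cyclic_graph G)\<^esub> y'"
  proof (cases "p = q")
    case True
    then obtain i :: nat where "y' = x' [^] i"
      using commuting_same_prime_order[OF fin pc y'(1) x'(1) comm'[symmetric] x'(3) _ x'(4,2)] y'(4) by blast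
    then show ?thesis using reachable_power[OF fin x'(1), of i] y'(2) by simp
  next
    case False
    then have "coprime p q" using x'(3) y'(3) by (simp add: primes_coprime)
    then obtain i j where i: "[i = 1] (mod p)" "[i = 0] (mod q)" and j: "[j = 0] (mod p)" "[j = 1] (mod q)"
      using binary_chinese_remainder_nat by meson
    have pow: "(x' \<otimes> y') [^] n = x' [^] n \<otimes> y' [^] n" for n :: nat
      using comm' x'(1) y'(1) by (rule pow_mult_distrib)
    show ?thesis
    proof (rule reachable_if_powers[OF fin, where w = "x' \<otimes> y'"])
      show "x' \<otimes> y' \<in> generate G {x', y'}" by (intro generate.eng generate.incl) auto
      have "x' [^] i = x' [^] (1::nat)" "y' [^] i = y' [^] (0::nat)"
        "x' [^] j = x' [^] (0::nat)" "y' [^] j = y' [^] (1::nat)"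
        using i j x'(1) y'(1) by (intro pow_eq_pow_if_cong; simp add: p_def q_def)+
      then show "x' = (x' \<otimes> y') [^] i" "y' = (x' \<otimes> y') [^] j"
        using pow x'(1) y'(1) by simp_all
    qed (use x' y' in auto)
  qed
  moreover have "x \<rightarrow>\<^sup>*\<^bsub>with_proj (cyclic_graph G)\<^esub> x'"
    unfolding x'_def using reachable_power fin x k(2) by simp
  moreover have "y \<rightarrow>\<^sup>*\<^bsub>with_proj (cyclic_graph G)\<^esub> y'"
    unfolding y'_def using reachable_power fin y l(2) by simp
  ultimately show ?thesis by (meson reachable_trans symmetric_reachable')
qed

end

section \<open>Malnormal subgroups and the cyclic graph\<close>

context group
begin

lemma mem_inv_coset_iff:
  assumes "H \<subseteq> carrier G" "g \<in> carrier G" "y \<in> carrier G"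
  shows "y \<in> (inv g <# H) #> g \<longleftrightarrow> conjugate g y \<in> H"
proof
  assume "y \<in> (inv g <# H) #> g"
  then obtain h where h: "h \<in> H" "y = inv g \<otimes> h \<otimes> g" by (auto simp: l_coset_def r_coset_def)
  then have "conjugate g y = h" using assms(1,2) by (auto simp: m_assoc)
  then show "conjugate g y \<in> H" using h(1) by simp
next
  assume "conjugate g y \<in> H"
  moreover have "y = inv g \<otimes> conjugate g y \<otimes> g" using assms(2,3) by (simp add: m_assoc)
  ultimately show "y \<in> (inv g <# H) #> g" unfolding l_coset_def r_coset_def by blast
qed

lemma Frobenius_group_iff_malnormal:
  "Frobenius_group G \<longleftrightarrow>
    (\<exists>H. subgroup H G \<and> H \<noteq> {\<one>} \<and> H \<noteq> carrier G \<and>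
      (\<forall>g\<in>carrier G - H. \<forall>y\<in>H. conjugate g y \<in> H \<longrightarrow> y = \<one>))"
proof -
  have "H \<inter> ((inv g <# H) #> g) = {\<one>} \<longleftrightarrow> (\<forall>y\<in>H. conjugate g y \<in> H \<longrightarrow> y = \<one>)"
    if H: "subgroup H G" and g: "g \<in> carrier G - H" for H g
  proof -
    have Hc: "H \<subseteq> carrier G" using H by (rule subgroup.subset)
    have "y \<in> H \<inter> ((inv g <# H) #> g) \<longleftrightarrow> y \<in> H \<and> conjugate g y \<in> H" for y
      using mem_inv_coset_iff[OF Hc, of g y] g subsetD[OF Hc, of y] by blast
    moreover have "\<one> \<in> H" "conjugate g \<one> = \<one>" using H g by (simp_all add: subgroup.one_closed)
    ultimately show ?thesis by (auto simp: set_eq_iff)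
  qed
  then show ?thesis unfolding Frobenius_group_def using is_group by (simp cong: conj_cong)
qed

text \<open>
  Adjacent elements commute, and an element that commutes with some \<open>y \<noteq> \<one>\<close> of a malnormal subgroup lies
  in that subgroup. Hence no edge leaves \<open>H\<close>.
\<close>

lemma disconnected_if_malnormal:
  assumes fin: "finite (carrier G)" and H: "subgroup H G" "H \<noteq> {\<one>}" "H \<noteq> carrier G"
    and malnormal: "\<forall>g\<in>carrier G - H. \<forall>y\<in>H. conjugate g y \<in> H \<longrightarrow> y = \<one>"
  shows "disconnected (with_proj (cyclic_graph G))"
proof -
  interpret pair_graph "cyclic_graph G" using fin by (rule pair_graph_cyclic_graph)
  have Hc: "H \<subseteq> carrier G" and one: "\<one> \<in> H"
    using H(1) by (auto simp: subgroup.one_closed dest: subgroup.subset)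
  obtain h where h: "h \<in> H" "h \<noteq> \<one>" using H(2) one by blast
  obtain v where v: "v \<in> carrier G" "v \<notin> H" using H(3) Hc by blast
  have step: "y \<in> H" if xy: "(x, y) \<in> parcs (cyclic_graph G)" and x: "x \<in> H" for x y
  proof (rule ccontr)
    assume "y \<notin> H"
    have c: "x \<in> carrier G" "x \<noteq> \<one>" "y \<in> carrier G"
      using xy by (auto simp: cyclic_graph_def)
    have "conjugate y x = x" using commute_if_adjacent[OF xy] c by (simp add: conj_eq_self_iff)
    then show False using malnormal c x \<open>y \<notin> H\<close> by simp
  qed
  have "y \<in> H" if "h \<rightarrow>\<^sup>*\<^bsub>with_proj (cyclic_graph G)\<^esub> y" for y
    using that by (induction rule: reachable_induct) (auto intro: h step)
  then have "\<not> h \<rightarrow>\<^sup>*\<^bsub>with_proj (cyclic_graph G)\<^esub> v" using v(2) by blast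
  moreover have "h \<in> carrier G - {\<one>}" "v \<in> carrier G - {\<one>}" using h v one Hc by auto
  ultimately show ?thesis unfolding disconnected_def by (auto simp: cyclic_graph_def)
qed

lemma centralizer_subgroup:
  assumes "finite (carrier G)" "x \<in> carrier G"
  shows "subgroup {g \<in> carrier G. g \<otimes> x = x \<otimes> g} G"
proof (rule subgroup_if_mult_closed[OF assms(1)])
  fix g h assume gh: "g \<in> {g \<in> carrier G. g \<otimes> x = x \<otimes> g}" "h \<in> {g \<in> carrier G. g \<otimes> x = x \<otimes> g}"
  then have c: "g \<in> carrier G" "h \<in> carrier G" "g \<otimes> x = x \<otimes> g" "h \<otimes> x = x \<otimes> h" by auto
  have "g \<otimes> h \<otimes> x = g \<otimes> x \<otimes> h" using c(1,2,4) assms(2) by (simp add: m_assoc)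
  also have "\<dots> = x \<otimes> g \<otimes> h" using c(3) by simp
  also have "\<dots> = x \<otimes> (g \<otimes> h)" using c(1,2) assms(2) by (simp add: m_assoc)
  finally show "g \<otimes> h \<in> {g \<in> carrier G. g \<otimes> x = x \<otimes> g}" using c by simp
qed (use assms(2) in auto)

text \<open>
  The automorphisms of a cyclic group commute with each other, so a commutator acts trivially on \<open>\<langle>z\<rangle>\<close>.
\<close>

lemma commutator_centralizes_normal_cyclic:
  assumes z: "z \<in> carrier G"
    and norm: "\<And>g. g \<in> carrier G \<Longrightarrow> \<exists>i::nat. conjugate g z = z [^] i"
    and g: "g \<in> carrier G" and h: "h \<in> carrier G"
  shows "conjugate (conjugate g h \<otimes> inv h) z = z"
proof -
  have swap: "conjugate (g \<otimes> h) z = conjugate (h \<otimes> g) z"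
  proof -
    obtain i j :: nat where ij: "conjugate g z = z [^] i" "conjugate h z = z [^] j"
      using norm[OF g] norm[OF h] by blast
    have "conjugate (g \<otimes> h) z = conjugate g (z [^] j)" using g h z by (simp add: ij(2) flip: conj_conj)
    also have "\<dots> = z [^] (i * j)" using g z by (simp add: conj_pow ij(1) nat_pow_pow)
    also have "\<dots> = conjugate h (z [^] i)" using h z by (simp add: conj_pow ij(2) nat_pow_pow mult.commute)
    also have "\<dots> = conjugate (h \<otimes> g) z" using g h z by (simp add: ij(1) flip: conj_conj)
    finally show ?thesis .
  qed
  have gh: "g \<otimes> h \<in> carrier G" and hg: "h \<otimes> g \<in> carrier G" using g h by simp_all
  obtain l :: nat where l: "conjugate (inv (h \<otimes> g)) z = z [^] l" using norm[of "inv (h \<otimes> g)"] hg by blast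
  have "conjugate g h \<otimes> inv h = (g \<otimes> h) \<otimes> inv (h \<otimes> g)" using g h by (simp add: m_assoc inv_mult_group)
  then have "conjugate (conjugate g h \<otimes> inv h) z = conjugate (g \<otimes> h) (conjugate (inv (h \<otimes> g)) z)"
    using conj_conj[OF gh _ z, of "inv (h \<otimes> g)"] hg by simp
  also have "\<dots> = conjugate (g \<otimes> h) (z [^] l)" by (simp only: l)
  also have "\<dots> = conjugate (h \<otimes> g) (z [^] l)"
    using conj_pow[OF gh z, of l] conj_pow[OF hg z, of l] swap by simp
  also have "\<dots> = conjugate (h \<otimes> g) (conjugate (inv (h \<otimes> g)) z)" by (simp only: l)
  also have "\<dots> = z" using conj_inv_cancel(2)[OF hg z] .
  finally show ?thesis .
qed

text \<open>
  Let \<open>B\<close> be the centralizer of \<open>x\<close> and \<open>K\<close> that of \<open>z\<close>; by assumption no nontrivial element of \<open>K\<close>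
  commutes with a nontrivial element of \<open>B\<close>. All commutators lie in \<open>K\<close>. The map
  \<open>k \<mapsto> k x k\<inverse> x\<inverse>\<close> from \<open>K\<close> to \<open>K\<close> is injective since \<open>K\<close> meets \<open>B\<close> trivially, hence it is
  surjective. So each conjugate of \<open>x\<close> is already a conjugate under \<open>K\<close>, which gives a factorization
  \<open>g = k \<otimes> c\<close> with \<open>k \<in> K\<close> and \<open>c \<in> B\<close>. If \<open>g b g\<inverse> \<in> B\<close>, then \<open>d = c b c\<inverse>\<close> and \<open>k d k\<inverse>\<close> are two
  elements of \<open>B\<close> that differ by an element of \<open>K\<close>, hence they are equal. So \<open>k\<close> commutes with
  \<open>d \<noteq> \<one>\<close>, and \<open>k = \<one>\<close>.
\<close>

lemma centralizer_malnormal: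
  assumes fin: "finite (carrier G)"
    and z: "z \<in> carrier G" and norm: "\<And>g. g \<in> carrier G \<Longrightarrow> \<exists>i::nat. conjugate g z = z [^] i"
    and x: "x \<in> carrier G" "x \<noteq> \<one>"
    and separated: "\<And>b k. b \<in> carrier G \<Longrightarrow> b \<noteq> \<one> \<Longrightarrow> b \<otimes> x = x \<otimes> b \<Longrightarrow>
      k \<in> carrier G \<Longrightarrow> k \<otimes> z = z \<otimes> k \<Longrightarrow> k \<otimes> b = b \<otimes> k \<Longrightarrow> k = \<one>"
    and g: "g \<in> carrier G" and b: "b \<in> carrier G" "b \<otimes> x = x \<otimes> b" "b \<noteq> \<one>"
    and conj_b: "conjugate g b \<otimes> x = x \<otimes> conjugate g b"
  shows "g \<otimes> x = x \<otimes> g"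
proof -
  define B where "B = {b \<in> carrier G. b \<otimes> x = x \<otimes> b}"
  define K where "K = {k \<in> carrier G. k \<otimes> z = z \<otimes> k}"
  have BG: "subgroup B G" and KG: "subgroup K G"
    unfolding B_def K_def using fin x(1) z by (simp_all add: centralizer_subgroup)
  have Bc: "B \<subseteq> carrier G" and Kc: "K \<subseteq> carrier G" by (auto simp: B_def K_def)
  have sep: "k = \<one>" if "k \<in> K" "c \<in> B" "c \<noteq> \<one>" "k \<otimes> c = c \<otimes> k" for k c
    using that separated[of c k] by (simp add: B_def K_def)
  have KB: "k = \<one>" if "k \<in> K" "k \<in> B" for k
    using that sep[of k x] x by (simp add: B_def)
  have comm_K: "conjugate a c \<otimes> inv c \<in> K" if "a \<in> carrier G" "c \<in> carrier G" for a c
    using that commutator_centralizes_normal_cyclic[OF z norm that] z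
    by (simp add: K_def conj_eq_self_iff)
  define \<phi> where "\<phi> k = conjugate k x \<otimes> inv x" for k
  have "\<phi> ` K = K"
  proof (rule endo_inj_surj)
    show "finite K" using fin Kc by (rule finite_subset[rotated])
    show "\<phi> ` K \<subseteq> K" using comm_K x(1) Kc by (auto simp: \<phi>_def)
    show "inj_on \<phi> K"
    proof (rule inj_onI)
      fix k l assume kl: "k \<in> K" "l \<in> K" "\<phi> k = \<phi> l"
      then have c: "k \<in> carrier G" "l \<in> carrier G" using Kc by auto
      have "conjugate k x = conjugate l x" using kl(3) c x(1) by (simp add: \<phi>_def)
      then have "conjugate (inv k) (conjugate l x) = x" using conj_inv_cancel(1)[OF c(1) x(1)] by simp
      then have "conjugate (inv k \<otimes> l) x = x" using conj_conj[of "inv k" l x] c x(1) by simp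
      then have "inv k \<otimes> l \<in> B" using c x(1) by (simp add: B_def conj_eq_self_iff)
      moreover have "inv k \<otimes> l \<in> K"
        using KG kl by (simp add: subgroup.m_closed subgroup.m_inv_closed)
      ultimately have "inv k \<otimes> l = \<one>" by (rule KB[rotated])
      then have "k \<otimes> (inv k \<otimes> l) = k" using c by simp
      then show "k = l" using c by simp
    qed
  qed
  then obtain k where k: "k \<in> K" "conjugate g x \<otimes> inv x = \<phi> k" using comm_K[OF g x(1)] by blast
  then have kc: "k \<in> carrier G" using Kc by blast
  define c where "c = inv k \<otimes> g"
  have cc: "c \<in> carrier G" and g_eq: "g = k \<otimes> c" using kc g by (simp_all add: c_def)
  have "conjugate g x = conjugate k x" using k(2) kc g x(1) by (simp add: \<phi>_def)
  then have "conjugate c x = x"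
    using conj_conj[of "inv k" g x] conj_inv_cancel(1)[OF kc x(1)] kc g x(1) by (simp add: c_def)
  then have cB: "c \<in> B" using cc x(1) by (simp add: B_def conj_eq_self_iff)
  define d where "d = conjugate c b"
  have dB: "d \<in> B"
  proof -
    have "b \<in> B" using b by (simp add: B_def)
    then show ?thesis unfolding d_def using BG cB by (intro subgroup.m_closed subgroup.m_inv_closed)
  qed
  then have dc: "d \<in> carrier G" using Bc by blast
  have gb: "conjugate g b = conjugate k d"
    unfolding d_def g_eq using conj_conj[OF kc cc b(1)] by simp
  have "conjugate k d \<in> B" using conj_b g b(1) by (simp add: B_def flip: gb)
  then have "conjugate k d \<otimes> inv d \<in> B"
    using BG dB by (simp add: subgroup.m_closed subgroup.m_inv_closed)
  then have "conjugate k d \<otimes> inv d = \<one>" using KB comm_K[OF kc dc] by blast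
  then have "conjugate k d \<otimes> inv d \<otimes> d = \<one> \<otimes> d" by simp
  then have "conjugate k d = d" using kc dc by (simp add: m_assoc)
  then have "k \<otimes> d = d \<otimes> k" using kc dc by (simp add: conj_eq_self_iff)
  moreover have "d \<noteq> \<one>"
  proof
    assume "d = \<one>"
    then have "conjugate (inv c) (conjugate c b) = \<one>" using cc by (simp add: d_def)
    then show False using conj_inv_cancel(1)[OF cc b(1)] b(3) by simp
  qed
  ultimately have "k = \<one>" using sep k(1) dB by blast
  then have "g = c" using g_eq cc by simp
  then show ?thesis using cB by (simp add: B_def)
qed

text \<open>
  The Frobenius complement is the centralizer of any \<open>x\<close> outside the component of a generator \<open>z\<close> of a
  normal subgroup of prime order: were a nontrivial \<open>k\<close> to commute with \<open>z\<close> and with some \<open>b \<noteq> \<one>\<close> that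
  commutes with \<open>x\<close>, then the chain \<open>z\<close>, \<open>k\<close>, \<open>b\<close>, \<open>x\<close> of successively commuting elements would
  connect \<open>z\<close> to \<open>x\<close>.
\<close>

lemma Frobenius_if_disconnected:
  assumes fin: "finite (carrier G)" and pc: "prime_power_subgroups_cyclic G"
    and disc: "disconnected (with_proj (cyclic_graph G))"
  shows "Frobenius_group G"
proof -
  interpret pair_graph "cyclic_graph G" using fin by (rule pair_graph_cyclic_graph)
  let ?R = "\<lambda>x y. x \<rightarrow>\<^sup>*\<^bsub>with_proj (cyclic_graph G)\<^esub> y"
  note link = reachable_if_commute[OF fin pc]
  have "carrier G \<noteq> {\<one>}"
    using disc unfolding disconnected_def by (auto simp: cyclic_graph_def)
  then obtain z where z: "z \<in> carrier G" "z \<noteq> \<one>"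
    and norm: "\<And>g. g \<in> carrier G \<Longrightarrow> \<exists>i::nat. conjugate g z = z [^] i"
    using exists_normal_prime_order_subgroup[OF is_group fin pc] by blast
  obtain x where x: "x \<in> carrier G" "x \<noteq> \<one>" and not_R: "\<not> ?R z x"
    using disconnectedD[OF fin disc, of z] z by blast
  have separated: "k = \<one>"
    if b: "b \<in> carrier G" "b \<noteq> \<one>" "b \<otimes> x = x \<otimes> b"
      and k: "k \<in> carrier G" "k \<otimes> z = z \<otimes> k" "k \<otimes> b = b \<otimes> k" for b k
  proof (rule ccontr)
    assume "k \<noteq> \<one>"
    then have "?R z k" "?R k b" "?R b x" using z x b k link by simp_all
    then show False using not_R reachable_trans by blast
  qed
  let ?B = "{b \<in> carrier G. b \<otimes> x = x \<otimes> b}"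
  have "subgroup ?B G" using fin x(1) by (rule centralizer_subgroup)
  moreover have "?B \<noteq> {\<one>}" using x by blast
  moreover have "?B \<noteq> carrier G"
  proof
    assume "?B = carrier G"
    then have "z \<otimes> x = x \<otimes> z" using z(1) by blast
    then show False using not_R link z x by simp
  qed
  moreover have "\<forall>g\<in>carrier G - ?B. \<forall>y\<in>?B. conjugate g y \<in> ?B \<longrightarrow> y = \<one>"
  proof (intro ballI impI)
    fix g y assume g: "g \<in> carrier G - ?B" and y: "y \<in> ?B" and "conjugate g y \<in> ?B"
    then have conj_y: "conjugate g y \<otimes> x = x \<otimes> conjugate g y" by blast
    show "y = \<one>"
    proof (rule ccontr)
      assume "y \<noteq> \<one>"
      then have "g \<otimes> x = x \<otimes> g"
        using g y by (intro centralizer_malnormal[OF fin z(1) norm x _ _ _ _ _ conj_y])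
          (assumption | rule separated | simp)+
      then show False using g by blast
    qed
  qed
  ultimately show ?thesis unfolding Frobenius_group_iff_malnormal by blast
qed

end

theorem theorem1:
  fixes G :: "('a, 'b) monoid_scheme"
  assumes "finite (carrier G)" and "Z_group G"
  shows "disconnected (with_proj (cyclic_graph G)) \<longleftrightarrow> Frobenius_group G"
proof -
  interpret group G using assms(2) by (simp add: Z_group_def)
  show ?thesis
  proof
    assume "disconnected (with_proj (cyclic_graph G))"
    then show "Frobenius_group G"
      using assms Z_group_prime_power_subgroups_cyclic Frobenius_if_disconnected by blast
  next
    assume "Frobenius_group G"
    then show "disconnected (with_proj (cyclic_graph G))"
      unfolding Frobenius_group_iff_malnormal
      by (elim exE conjE) (rule disconnected_if_malnormal[OF assms(1)])
  qed
qed

end
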